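(* Let $p$ be a prime not dividing $6$. The supersingular Weber invariants on $\mathcal{W}_{24}$ in characteristic $p$ are defined over $\mathbb{F}_{p^2}$; that is, every point of $\mathcal{W}_{24}(\overline{\mathbb{F}}_p)$ lying above a supersingular $j$-invariant is $\mathbb{F}_{p^2}$-rational.
   Context: Over $\overline{\mathbb{F}}_p$, fix a square root $\sqrt2$ of $2$ (it lies in $\mathbb{F}_{p^2}$). The Weber curve $\mathcal{W}_{24}$ is the curve in $\mathbb{P}^3$ defined by $$X_0^8+X_1^8+X_2^8=0,\qquad X_0X_1X_2=\sqrt2\,X_3^3 .$$ It is equipped with the map to the $j$-line $X(1)$ given, on points $(u_0:u_1:u_2:1)$, by $$j=\frac{(u_0^{24}-16)^3}{u_0^{24}}=\frac{(u_1^{24}-16)^3}{u_1^{24}}=\frac{(u_2^{24}-16)^3}{u_2^{24}}.$$ The points above finite values of $j$ are those with $X_3\neq0$. A supersingular Weber invariant on $\mathcal{W}_{24}$ is a point over $\overline{\mathbb{F}}_p$ whose image $j$ is the $j$-invariant of a supersingular elliptic curve in characteristic $p$. *)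

theory Defs
  imports "HOL-Computational_Algebra.Computational_Algebra"
begin

text \<open>In characteristic \<open>p\<close> the set \<open>\<int>\<close>, the image of the integers, is the prime
  field. So the following says that the (algebraically closed) type is an algebraic closure of
  the field with \<open>p\<close> elements.\<close>

definition is_alg_closure_Fp :: "nat \<Rightarrow> 'a::alg_closed_field itself \<Rightarrow> bool" where
  "is_alg_closure_Fp p (_ :: 'a itself) \<longleftrightarrow> CHAR('a) = p \<and>
     (\<forall>x::'a. \<exists>f::'a poly. f \<noteq> 0 \<and> (\<forall>i. coeff f i \<in> \<int>) \<and> poly f x = 0)"

text \<open>The subfield with \<open>q\<close> elements of an algebraic closure, for \<open>q\<close> a positive power of the
  characteristic.\<close>

definition Fq :: "nat \<Rightarrow> 'a::field set" where
  "Fq q = {x. x ^ q = x}"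


subsection \<open>Projective space of dimension 3\<close>

definition proj3_rel :: "'a::field \<times> 'a \<times> 'a \<times> 'a \<Rightarrow> 'a \<times> 'a \<times> 'a \<times> 'a \<Rightarrow> bool" where
  "proj3_rel = (\<lambda>X (Y0, Y1, Y2, Y3). X \<noteq> (0, 0, 0, 0) \<and>
     (\<exists>c. c \<noteq> 0 \<and> X = (c * Y0, c * Y1, c * Y2, c * Y3)))"

lemma proj3_relE:
  assumes "proj3_rel X Y"
  obtains Y0 Y1 Y2 Y3 c where "Y = (Y0, Y1, Y2, Y3)" "c \<noteq> 0" "X \<noteq> (0, 0, 0, 0)"
    "X = (c * Y0, c * Y1, c * Y2, c * Y3)"
  using assms unfolding proj3_rel_def by (cases Y) (simp only: prod.case, blast)

lemma part_equivp_proj3_rel: "part_equivp (proj3_rel :: 'a::field \<times> 'a \<times> 'a \<times> 'a \<Rightarrow> _)"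
proof (rule part_equivpI)
  show "\<exists>X :: 'a \<times> 'a \<times> 'a \<times> 'a. proj3_rel X X"
    by (rule exI[of _ "(1, 0, 0, 0)"]) (auto simp: proj3_rel_def intro!: exI[of _ 1])
  show "symp (proj3_rel :: 'a \<times> 'a \<times> 'a \<times> 'a \<Rightarrow> _)"
  proof (rule sympI)
    fix X Y :: "'a \<times> 'a \<times> 'a \<times> 'a"
    assume "proj3_rel X Y"
    then obtain Y0 Y1 Y2 Y3 c where "Y = (Y0, Y1, Y2, Y3)" "c \<noteq> 0" "X \<noteq> (0, 0, 0, 0)"
      "X = (c * Y0, c * Y1, c * Y2, c * Y3)"
      by (rule proj3_relE)
    then show "proj3_rel Y X"
      by (auto simp: proj3_rel_def intro!: exI[of _ "inverse c"])
  qed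
  show "transp (proj3_rel :: 'a \<times> 'a \<times> 'a \<times> 'a \<Rightarrow> _)"
  proof (rule transpI)
    fix X Y Z :: "'a \<times> 'a \<times> 'a \<times> 'a"
    assume "proj3_rel X Y" "proj3_rel Y Z"
    then obtain Z0 Z1 Z2 Z3 c d where "Z = (Z0, Z1, Z2, Z3)" "c \<noteq> 0" "d \<noteq> 0"
      "X \<noteq> (0, 0, 0, 0)" "X = (c * (d * Z0), c * (d * Z1), c * (d * Z2), c * (d * Z3))"
      by (elim proj3_relE) auto
    then show "proj3_rel X Z"
      by (auto simp: proj3_rel_def mult.assoc intro!: exI[of _ "c * d"])
  qed
qed

quotient_type (overloaded) 'a proj3 = "'a::field \<times> 'a \<times> 'a \<times> 'a" / partial: proj3_rel
  by (rule part_equivp_proj3_rel)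

text \<open>A point is rational over a subfield \<open>F\<close> if some system of homogeneous coordinates of it
  lies in \<open>F\<close>.\<close>

lift_definition proj3_rational :: "'a::field set \<Rightarrow> 'a proj3 \<Rightarrow> bool" is
  "\<lambda>F (X0, X1, X2, X3). \<exists>c. c \<noteq> 0 \<and> c * X0 \<in> F \<and> c * X1 \<in> F \<and> c * X2 \<in> F \<and> c * X3 \<in> F"
proof -
  fix F :: "'a set" and X Y :: "'a \<times> 'a \<times> 'a \<times> 'a"
  let ?R = "\<lambda>(X0, X1, X2, X3). \<exists>c. c \<noteq> 0 \<and> c * X0 \<in> F \<and> c * X1 \<in> F \<and> c * X2 \<in> F \<and> c * X3 \<in> F"
  assume XY: "proj3_rel X Y"
  have *: "?R W" if rel: "proj3_rel V W" and V: "?R V" for V W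
  proof -
    obtain W0 W1 W2 W3 c where VW: "W = (W0, W1, W2, W3)" "c \<noteq> 0"
      "V = (c * W0, c * W1, c * W2, c * W3)"
      using rel by (rule proj3_relE)
    then obtain d where "d \<noteq> 0" "d * (c * W0) \<in> F" "d * (c * W1) \<in> F"
      "d * (c * W2) \<in> F" "d * (c * W3) \<in> F"
      using V by auto
    with VW show ?thesis by (auto simp: mult.assoc intro!: exI[of _ "d * c"])
  qed
  have "proj3_rel Y X"
    using XY part_equivp_symp[OF part_equivp_proj3_rel] by blast
  with XY * show "?R X = ?R Y" by blast
qed


subsection \<open>The Weber curve\<close>

text \<open>The parameter \<open>r\<close> is the chosen square root of 2.\<close>

lift_definition on_W24 :: "'a::field \<Rightarrow> 'a proj3 \<Rightarrow> bool" is
  "\<lambda>r (X0, X1, X2, X3). X0 ^ 8 + X1 ^ 8 + X2 ^ 8 = 0 \<and> X0 * X1 * X2 = r * X3 ^ 3"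
proof -
  fix r :: 'a and X Y :: "'a \<times> 'a \<times> 'a \<times> 'a"
  assume "proj3_rel X Y"
  then obtain Y0 Y1 Y2 Y3 c where XY: "Y = (Y0, Y1, Y2, Y3)" "c \<noteq> 0"
    "X = (c * Y0, c * Y1, c * Y2, c * Y3)"
    by (rule proj3_relE)
  have "(c * Y0) ^ 8 + (c * Y1) ^ 8 + (c * Y2) ^ 8 = c ^ 8 * (Y0 ^ 8 + Y1 ^ 8 + Y2 ^ 8)"
    by (simp add: power_mult_distrib algebra_simps)
  moreover have "c * Y0 * (c * Y1) * (c * Y2) = c ^ 3 * (Y0 * Y1 * Y2)"
    "r * (c * Y3) ^ 3 = c ^ 3 * (r * Y3 ^ 3)"
    by (simp_all add: power3_eq_cube mult_ac)
  ultimately show "(case X of (X0, X1, X2, X3) \<Rightarrow>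
        X0 ^ 8 + X1 ^ 8 + X2 ^ 8 = 0 \<and> X0 * X1 * X2 = r * X3 ^ 3) =
      (case Y of (X0, X1, X2, X3) \<Rightarrow>
        X0 ^ 8 + X1 ^ 8 + X2 ^ 8 = 0 \<and> X0 * X1 * X2 = r * X3 ^ 3)"
    using XY(2) unfolding XY(1,3) prod.case by (metis mult_eq_0_iff mult_left_cancel power_not_zero)
qed

definition W24 :: "'a::field \<Rightarrow> 'a proj3 set" where
  "W24 r = {P. on_W24 r P}"

lift_definition at_infinity3 :: "'a::field proj3 \<Rightarrow> bool" is "\<lambda>(X0, X1, X2, X3). X3 = 0"
  by (auto simp: proj3_rel_def)

definition j_of_weber :: "'a::field \<Rightarrow> 'a" where
  "j_of_weber u = (u ^ 24 - 16) ^ 3 / u ^ 24"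

text \<open>The map to the \<open>j\<close>-line, given by the coordinate \<open>u\<^sub>0 = X\<^sub>0 / X\<^sub>3\<close>; it is meaningful only at
  points with \<open>X\<^sub>3 \<noteq> 0\<close>. On the curve the other two coordinates give the same value: see
  \<open>j_of_weber_eq\<close> below.\<close>

lift_definition W24_j :: "'a::field proj3 \<Rightarrow> 'a" is
  "\<lambda>(X0, X1, X2, X3). j_of_weber (X0 / X3)"
  by (auto simp: proj3_rel_def)

lemma j_of_weber_eq:
  fixes u0 u1 u2 r :: "'a::field"
  assumes "u0 ^ 8 + u1 ^ 8 + u2 ^ 8 = 0" "u0 * u1 * u2 = r" "r ^ 2 = 2" "(2::'a) \<noteq> 0"
  shows "j_of_weber u0 = j_of_weber u1" "j_of_weber u0 = j_of_weber u2"
proof -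
  have *: "j_of_weber (u::'a) = - ((w * v + u ^ 8 * (v + w)) ^ 3)"
    if "u ^ 8 + v + w = 0" "u ^ 8 * v * w = 16" for u v w
  proof -
    have "(16::'a) = 2 ^ 4" by simp
    then have "(16::'a) \<noteq> 0" using assms(4) by (metis power_not_zero)
    then have u: "u \<noteq> 0" using that(2) by auto
    have w: "w = - (u ^ 8 + v)" using that(1) by (metis add.commute minus_unique)
    have "(u ^ 8) ^ 3 - u ^ 8 * v * w = - (u ^ 8 * (w * v + u ^ 8 * (v + w)))"
      unfolding w by (simp add: algebra_simps power2_eq_square power3_eq_cube)
    then have "u ^ 24 - 16 = - (u ^ 8 * (w * v + u ^ 8 * (v + w)))"
      unfolding that(2) by (simp flip: power_mult)
    then have "(u ^ 24 - 16) ^ 3 = - ((u ^ 8) ^ 3 * (w * v + u ^ 8 * (v + w)) ^ 3)"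
      by (simp add: power_mult_distrib)
    then show ?thesis using u by (simp add: j_of_weber_def divide_simps flip: power_mult)
  qed
  have "u0 ^ 8 * u1 ^ 8 * u2 ^ 8 = (r ^ 2) ^ 4"
    by (simp add: assms(2)[symmetric] power_mult_distrib flip: power_mult)
  then have p: "u0 ^ 8 * u1 ^ 8 * u2 ^ 8 = 16" by (simp add: assms(3))
  show "j_of_weber u0 = j_of_weber u1"
    using *[of u0 "u1 ^ 8" "u2 ^ 8"] *[of u1 "u0 ^ 8" "u2 ^ 8"] assms(1) p
    by (simp add: algebra_simps)
  show "j_of_weber u0 = j_of_weber u2"
    using *[of u0 "u1 ^ 8" "u2 ^ 8"] *[of u2 "u0 ^ 8" "u1 ^ 8"] assms(1) p
    by (simp add: algebra_simps)
qed


subsection \<open>Supersingular elliptic curves\<close>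

text \<open>Since 2 and 3 will be invertible, every elliptic curve has a model
  \<open>y\<^sup>2 = x\<^sup>3 + a x + b\<close> with \<open>4 a\<^sup>3 + 27 b\<^sup>2 \<noteq> 0\<close>.\<close>

datatype 'a ec_point = Infinity | Affine 'a 'a

definition elliptic_curve :: "'a::field \<Rightarrow> 'a \<Rightarrow> bool" where
  "elliptic_curve a b \<longleftrightarrow> 4 * a ^ 3 + 27 * b ^ 2 \<noteq> 0"

definition ec_points :: "'a::field \<Rightarrow> 'a \<Rightarrow> 'a ec_point set" where
  "ec_points a b = {Infinity} \<union> {Affine x y |x y. y ^ 2 = x ^ 3 + a * x + b}"

text \<open>The chord and tangent law.\<close>

fun ec_add :: "'a::field \<Rightarrow> 'a ec_point \<Rightarrow> 'a ec_point \<Rightarrow> 'a ec_point" where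
  "ec_add a Infinity Q = Q"
| "ec_add a P Infinity = P"
| "ec_add a (Affine x1 y1) (Affine x2 y2) =
     (if x1 = x2 \<and> y1 = - y2 then Infinity
      else let m = (if x1 = x2 then (3 * x1 ^ 2 + a) / (2 * y1) else (y2 - y1) / (x2 - x1));
               x3 = m ^ 2 - x1 - x2
           in Affine x3 (m * (x1 - x3) - y1))"

definition ec_mult :: "'a::field \<Rightarrow> nat \<Rightarrow> 'a ec_point \<Rightarrow> 'a ec_point" where
  "ec_mult a n P = (ec_add a P ^^ n) Infinity"

definition ec_torsion :: "'a::field \<Rightarrow> 'a \<Rightarrow> nat \<Rightarrow> 'a ec_point set" where
  "ec_torsion a b n = {P \<in> ec_points a b. ec_mult a n P = Infinity}"

definition j_invariant :: "'a::field \<Rightarrow> 'a \<Rightarrow> 'a" where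
  "j_invariant a b = 1728 * (4 * a ^ 3) / (4 * a ^ 3 + 27 * b ^ 2)"

text \<open>A curve is supersingular if it has no geometric point of order \<open>p\<close>. The base field being
  algebraically closed, its points over the base field are its geometric points.\<close>

definition supersingular :: "'a::alg_closed_field \<Rightarrow> 'a \<Rightarrow> bool" where
  "supersingular a b \<longleftrightarrow> elliptic_curve a b \<and> ec_torsion a b CHAR('a) = {Infinity}"

definition supersingular_j :: "'a::alg_closed_field \<Rightarrow> bool" where
  "supersingular_j j \<longleftrightarrow> (\<exists>a b. supersingular a b \<and> j_invariant a b = j)"

definition supersingular_weber_invariants :: "'a::alg_closed_field \<Rightarrow> 'a proj3 set" where
  "supersingular_weber_invariants r =
     {P \<in> W24 r. \<not> at_infinity3 P \<and> supersingular_j (W24_j P)}"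

end

theory Submission
  imports Defs
begin

text \<open>
  On a supersingular curve over an algebraically closed field, multiplication by \<open>p\<close> has degree
  \<open>p\<^sup>2\<close> and is injective, so that on first coordinates it is given by \<open>x \<mapsto> x\<^sup>q / c\<close> with
  \<open>q = p\<^sup>2\<close>. A point \<open>(u\<^sub>0 : u\<^sub>1 : u\<^sub>2 : 1)\<close> of the Weber curve gives an elliptic curve with
  differences of 2-torsion points \<open>A\<^sub>i = u\<^sub>i\<^sup>8\<close>. On 2-, 3- and 4-torsion points, multiplication by
  \<open>p\<close> is \<open>\<plusminus>1\<close>; this gives \<open>c = 1\<close> and then \<open>u\<^sub>i\<^sup>4 \<in> F\<^sub>q\<close>, for every supersingular point. Quotients by
  2-torsion points are again supersingular and correspond to Weber points whose fourth powers are
  given in terms of \<open>u\<^sub>0\<^sup>2 u\<^sub>2\<^sup>2 (u\<^sub>0\<^sup>4 + i u\<^sub>2\<^sup>4)\<close>. So the rationality of fourth powers of all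
  supersingular points yields that of the squares, and in the same way the squares yield the
  coordinates themselves. No torsion of order 8 or 16 is needed, on which \<open>p\<close> need not act as \<open>\<plusminus>1\<close>.
\<close>

subsection \<open>The group law\<close>

text \<open>The constant \<open>c\<close> is a genuine obstacle: scaling the model by
  \<open>t\<close> multiplies it by a power of \<open>t\<close>, so only a normalised model can have
  \<open>c = 1\<close>. The normalisation used is that the product of the root differences is 16.
  Each passage to an isogenous point gains one square root: the eighth powers of its coordinates are
  given by fourth powers of the old ones, hence its fourth powers involve old squares. As the
  isogenous point is a new point, every stage has to be proved for all supersingular points at once.
  For the last stage it is not enough that a quantity lies in the field with \<open>p ^ 2\<close>
  elements; it must be a square there, which comes from comparing two isogenous points.
  Supersingularity is carried backwards along an isogeny, from the image to the source, since this
  only uses that the kernel has order prime to \<open>p\<close>. Hence the isogeny that is worked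
  out leads from the new curve to the old one. The auxiliary constants (a square root of -1, eighth
  roots of unity, the square root of 2) are rational because \<open>p ^ 2\<close> is 1 modulo
  24.\<close>

fun ec_neg :: "'a::field ec_point \<Rightarrow> 'a ec_point" where
  "ec_neg Infinity = Infinity"
| "ec_neg (Affine x y) = Affine x (- y)"

locale short_weierstrass =
  fixes a b :: "'a::alg_closed_field"
  assumes elliptic: "elliptic_curve a b"
    and two_neq_0: "(2::'a) \<noteq> 0" and three_neq_0: "(3::'a) \<noteq> 0"
begin

abbreviation "E \<equiv> ec_points a b"
abbreviation add (infixl "\<oplus>" 65) where "P \<oplus> Q \<equiv> ec_add a P Q"

lemma Infinity_in_E [simp]: "Infinity \<in> E"
  by (simp add: ec_points_def)

lemma Affine_in_E [simp]: "Affine x y \<in> E \<longleftrightarrow> y ^ 2 = x ^ 3 + a * x + b"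
  by (auto simp: ec_points_def)

lemma eq_uminus_self_iff: "(y::'a) = - y \<longleftrightarrow> y = 0"
proof
  assume "y = - y"
  then have "2 * y = 0" by algebra
  then show "y = 0" using two_neq_0 by simp
qed simp

lemma smooth:
  assumes "x ^ 3 + a * x + b = 0"
  shows "3 * x ^ 2 + a \<noteq> 0"
proof
  assume *: "3 * x ^ 2 + a = 0"
  have "4 * a ^ 3 + 27 * b ^ 2 = 0"
    using assms * by algebra
  then show False using elliptic by (simp add: elliptic_curve_def)
qed

text \<open>The two equations for the slope contain no division and so treat chord and tangent at
  once: the second is the difference of the two curve equations with the factor
  \<open>x2 - x1\<close> removed, and for equal points it is the tangent condition.\<close>

lemma ec_add_Affine:
  assumes "y2 = y1 + m * (x2 - x1)" "m * (y1 + y2) = x1 ^ 2 + x1 * x2 + x2 ^ 2 + a"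
    and "\<not> (x1 = x2 \<and> y1 = - y2)"
  shows "Affine x1 y1 \<oplus> Affine x2 y2 =
    Affine (m ^ 2 - x1 - x2) (- (y1 + m * (m ^ 2 - x1 - x2 - x1)))"
proof (cases "x1 = x2")
  case True
  then have "y1 = y2" using assms(1) by simp
  then have "y1 \<noteq> 0" using assms(3) True by auto
  then have "m = (3 * x1 ^ 2 + a) / (2 * y1)"
    using assms(2) True \<open>y1 = y2\<close> two_neq_0 by (simp add: field_simps power2_eq_square)
  then show ?thesis using True \<open>y1 = y2\<close> assms(3) by (simp add: Let_def algebra_simps)
next
  case False
  then have m: "(y2 - y1) / (x2 - x1) = m" using assms(1) by simp
  have "m * (x1 - t) - y1 = - (y1 + m * (t - x1))" for t by algebra
  with False m show ?thesis by (simp only: ec_add.simps Let_def simp_thms if_False)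
qed

lemma slope_exists:
  assumes "Affine x1 y1 \<in> E" "Affine x2 y2 \<in> E" "\<not> (x1 = x2 \<and> y1 = - y2)"
  obtains m where "y2 = y1 + m * (x2 - x1)"
    "m * (y1 + y2) = x1 ^ 2 + x1 * x2 + x2 ^ 2 + a"
proof (cases "x1 = x2")
  case True
  have "y1 ^ 2 = y2 ^ 2" using assms(1,2) True by simp
  then have "y1 = y2" using assms(3) True by (auto simp: power2_eq_iff)
  then have "y1 \<noteq> 0" using assms(3) True by auto
  show ?thesis
    by (rule that[of "(3 * x1 ^ 2 + a) / (2 * y1)"])
      (use True \<open>y1 = y2\<close> \<open>y1 \<noteq> 0\<close> two_neq_0 in
        \<open>auto simp: divide_simps power2_eq_square algebra_simps\<close>)
next
  case False
  define m where "m = (y2 - y1) / (x2 - x1)"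
  have m: "m * (x2 - x1) = y2 - y1" using False by (simp add: m_def)
  have "(x2 - x1) * (m * (y1 + y2)) = (x2 - x1) * (x1 ^ 2 + x1 * x2 + x2 ^ 2 + a)"
    using m assms(1,2) unfolding Affine_in_E by algebra
  then have "m * (y1 + y2) = x1 ^ 2 + x1 * x2 + x2 ^ 2 + a" using False by simp
  then show ?thesis using m by (intro that[of m]) (auto simp: algebra_simps)
qed

lemma ec_neg_in_E [simp]: "P \<in> E \<Longrightarrow> ec_neg P \<in> E"
  by (cases P) auto

lemma ec_neg_neg [simp]: "ec_neg (ec_neg P) = P"
  by (cases P) auto

lemma ec_add_Infinity_right [simp]: "P \<oplus> Infinity = P"
  by (cases P) auto

lemma ec_add_neg_right [simp]: "P \<oplus> ec_neg P = Infinity"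
  by (cases P) auto

lemma ec_add_neg_left [simp]: "ec_neg P \<oplus> P = Infinity"
  by (cases P) auto

lemma ec_add_closed [simp]:
  assumes "P \<in> E" "Q \<in> E"
  shows "P \<oplus> Q \<in> E"
proof (cases "P = Infinity \<or> Q = Infinity \<or> Q = ec_neg P")
  case True
  then show ?thesis using assms by auto
next
  case False
  then obtain x1 y1 x2 y2 where PQ: "P = Affine x1 y1" "Q = Affine x2 y2"
    by (metis ec_point.exhaust)
  have ne: "\<not> (x1 = x2 \<and> y1 = - y2)" using False PQ by auto
  obtain m where m: "y2 = y1 + m * (x2 - x1)"
    "m * (y1 + y2) = x1 ^ 2 + x1 * x2 + x2 ^ 2 + a"
    using slope_exists assms ne unfolding PQ by metis
  show ?thesis
    using m assms unfolding PQ ec_add_Affine[OF m ne] Affine_in_E by algebra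
qed

lemma ec_add_commute:
  assumes "P \<in> E" "Q \<in> E"
  shows "P \<oplus> Q = Q \<oplus> P"
proof (cases "P = Infinity \<or> Q = Infinity \<or> Q = ec_neg P")
  case True
  then show ?thesis by auto
next
  case False
  then obtain x1 y1 x2 y2 where PQ: "P = Affine x1 y1" "Q = Affine x2 y2"
    by (metis ec_point.exhaust)
  have ne: "\<not> (x1 = x2 \<and> y1 = - y2)" "\<not> (x2 = x1 \<and> y2 = - y1)" using False PQ by auto
  obtain m where m: "y2 = y1 + m * (x2 - x1)"
    "m * (y1 + y2) = x1 ^ 2 + x1 * x2 + x2 ^ 2 + a"
    using slope_exists assms ne unfolding PQ by metis
  have m': "y1 = y2 + m * (x1 - x2)" "m * (y2 + y1) = x2 ^ 2 + x2 * x1 + x1 ^ 2 + a"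
    using m by algebra+
  show ?thesis
    unfolding PQ ec_add_Affine[OF m ne(1)] ec_add_Affine[OF m' ne(2)]
    using m by (auto simp: algebra_simps)
qed

text \<open>The line through \<open>P\<close>, \<open>Q\<close> and the negative of their sum,
  reflected in the first axis, has slope \<open>- m\<close> and passes through the sum,
  \<open>ec_neg Q\<close> and \<open>ec_neg P\<close>. This fragment of associativity already yields
  cancellation, which the proof of full associativity uses.\<close>

lemma ec_add_neg_cancel:
  assumes "P \<in> E" "Q \<in> E"
  shows "P \<oplus> Q \<oplus> ec_neg Q = P"
proof (cases "P = Infinity \<or> Q = Infinity \<or> Q = ec_neg P")
  case True
  then show ?thesis by auto
next
  case False
  then obtain x1 y1 x2 y2 where PQ: "P = Affine x1 y1" "Q = Affine x2 y2"
    by (metis ec_point.exhaust)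
  have ne: "\<not> (x1 = x2 \<and> y1 = - y2)" using False PQ by auto
  obtain m where m: "y2 = y1 + m * (x2 - x1)"
    "m * (y1 + y2) = x1 ^ 2 + x1 * x2 + x2 ^ 2 + a"
    using slope_exists assms ne unfolding PQ by metis
  define x3 y3 where "x3 = m ^ 2 - x1 - x2" and "y3 = y1 + m * (x3 - x1)"
  have S: "P \<oplus> Q = Affine x3 (- y3)"
    unfolding PQ ec_add_Affine[OF m ne] by (simp add: x3_def y3_def)
  have m': "- y2 = - y3 + (- m) * (x2 - x3)"
    "(- m) * (- y3 + - y2) = x3 ^ 2 + x3 * x2 + x2 ^ 2 + a"
    using m x3_def y3_def by algebra+
  \<comment> \<open>If the sum of \<open>P\<close> and \<open>Q\<close> were \<open>Q\<close>, the
    slope equations would make \<open>(x2, 0)\<close> a singular point.\<close>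
  have ne': "\<not> (x3 = x2 \<and> - y3 = - (- y2))"
  proof
    assume *: "x3 = x2 \<and> - y3 = - (- y2)"
    with m'(1) have y2: "y2 = 0" using eq_uminus_self_iff[of y2] by simp
    have "3 * x2 ^ 2 + a = 0" using m'(2) * y2 by (simp add: power2_eq_square algebra_simps)
    moreover have "x2 ^ 3 + a * x2 + b = 0" using assms(2) PQ y2 by simp
    ultimately show False using smooth by blast
  qed
  have "(- m) ^ 2 - x3 - x2 = x1" using x3_def by algebra
  moreover have "- (- y3 + (- m) * (x1 - x3)) = y1" using y3_def by algebra
  ultimately have "Affine x3 (- y3) \<oplus> Affine x2 (- y2) = Affine x1 y1"
    unfolding ec_add_Affine[OF m' ne'] by (simp only:)
  moreover have "ec_neg Q = Affine x2 (- y2)" by (simp add: PQ)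
  ultimately have "P \<oplus> Q \<oplus> ec_neg Q = Affine x1 y1" by (simp only: S)
  then show ?thesis by (simp only: PQ(1))
qed

lemma ec_add_left_cancel:
  assumes "P \<in> E" "Q \<in> E" "R \<in> E" "R \<oplus> P = R \<oplus> Q"
  shows "P = Q"
  using ec_add_neg_cancel[of P R] ec_add_neg_cancel[of Q R] ec_add_commute assms by metis

lemma ec_add_right_cancel:
  assumes "P \<in> E" "Q \<in> E" "R \<in> E" "P \<oplus> R = Q \<oplus> R"
  shows "P = Q"
  using ec_add_neg_cancel[of P R] ec_add_neg_cancel[of Q R] assms by metis

lemma ec_add_eq_iff:
  assumes "P \<in> E" "Q \<in> E" "R \<in> E"
  shows "P \<oplus> Q = R \<longleftrightarrow> Q = R \<oplus> ec_neg P"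
proof -
  have "P \<oplus> (R \<oplus> ec_neg P) = R"
    using ec_add_neg_cancel[of R "ec_neg P"] assms ec_add_commute by (metis ec_add_closed ec_neg_in_E ec_neg_neg)
  moreover have "Q \<oplus> P \<oplus> ec_neg P = Q" using ec_add_neg_cancel assms by blast
  ultimately show ?thesis using assms ec_add_commute by metis
qed

text \<open>Associativity of a generic sum holds because the four zeros of a function
  \<open>y - (\<alpha> x\<^sup>2 + \<beta> x + \<gamma>)\<close> on the curve have sum zero, and three of them determine the function.
  The equations are those of the coefficients of
  \<open>x\<^sup>3 + a x + b - (\<alpha> x\<^sup>2 + \<beta> x + \<gamma>)\<^sup>2 = - \<alpha>\<^sup>2 (x - x\<^sub>1) (x - x\<^sub>2) (x - x\<^sub>3) (x - x\<^sub>4)\<close>.\<close>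

definition on_parabola :: "'a \<times> 'a \<times> 'a \<Rightarrow> 'a \<Rightarrow> 'a \<Rightarrow> 'a \<Rightarrow> 'a \<Rightarrow> bool" where
  "on_parabola = (\<lambda>(\<alpha>, \<beta>, \<gamma>) x1 x2 x3 x4. \<alpha> \<noteq> 0 \<and>
     1 - 2 * \<alpha> * \<beta> = \<alpha> ^ 2 * (x1 + x2 + x3 + x4) \<and>
     \<beta> ^ 2 + 2 * \<alpha> * \<gamma> = \<alpha> ^ 2 * (x1 * x2 + x1 * x3 + x1 * x4 + x2 * x3 + x2 * x4 + x3 * x4) \<and>
     a - 2 * \<beta> * \<gamma> = \<alpha> ^ 2 * (x1 * x2 * x3 + x1 * x2 * x4 + x1 * x3 * x4 + x2 * x3 * x4) \<and>
     b - \<gamma> ^ 2 = - (\<alpha> ^ 2 * (x1 * x2 * x3 * x4)))"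

text \<open>The function sought is the product of the line through the first two points and the line
  through their sum and the third point, divided by \<open>x - xS\<close>. Modulo the curve equation
  it is linear in \<open>y\<close>.\<close>

lemma add_add_on_parabola:
  assumes E: "Affine x1 y1 \<in> E" "Affine x2 y2 \<in> E" "Affine x3 y3 \<in> E"
    and ne: "\<not> (x1 = x2 \<and> y1 = - y2)" "Affine x3 y3 \<noteq> Affine x1 (- y1)"
      "Affine x3 y3 \<noteq> Affine x2 (- y2)"
    and S: "Affine x1 y1 \<oplus> Affine x2 y2 = Affine xS yS" "xS \<noteq> x3"
  shows "\<exists>\<alpha> \<beta> \<gamma> x4 y4. Affine x1 y1 \<oplus> Affine x2 y2 \<oplus> Affine x3 y3 = Affine x4 y4 \<and>
    on_parabola (\<alpha>, \<beta>, \<gamma>) x1 x2 x3 x4 \<and>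
    y1 = \<alpha> * x1 ^ 2 + \<beta> * x1 + \<gamma> \<and> y2 = \<alpha> * x2 ^ 2 + \<beta> * x2 + \<gamma> \<and>
    y3 = \<alpha> * x3 ^ 2 + \<beta> * x3 + \<gamma> \<and> - y4 = \<alpha> * x4 ^ 2 + \<beta> * x4 + \<gamma>"
proof -
  obtain m where m: "y2 = y1 + m * (x2 - x1)"
    "m * (y1 + y2) = x1 ^ 2 + x1 * x2 + x2 ^ 2 + a"
    using slope_exists E ne by metis
  have xS: "xS = m ^ 2 - x1 - x2" and yS: "yS = - (y1 + m * (xS - x1))"
    using S(1) unfolding ec_add_Affine[OF m ne(1)] by auto
  have SE: "Affine xS yS \<in> E" using ec_add_closed E S(1) by metis
  obtain n where n: "y3 = yS + n * (x3 - xS)"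
    "n * (yS + y3) = xS ^ 2 + xS * x3 + x3 ^ 2 + a"
    using slope_exists SE E(3) S(2) by metis
  define x4 y4 where "x4 = n ^ 2 - xS - x3" and "y4 = - (yS + n * (x4 - xS))"
  have T: "Affine xS yS \<oplus> Affine x3 y3 = Affine x4 y4"
    using ec_add_Affine[OF n] S(2) by (simp add: x4_def y4_def)
  \<comment> \<open>Up to sign, \<open>k\<close> is the coefficient of \<open>y\<close> in that
    function. If it vanished, the function would be \<open>(x - x1) * (x - x2)\<close>, and its zero
    at the third point would make that point the negative of one of the first two.\<close>
  define k where "k = m + n"
  have k0: "k \<noteq> 0"
  proof
    assume "k = 0"
    then have "n = - m" by (simp add: k_def eq_neg_iff_add_eq_0 add.commute)
    then have y3: "y3 = - (y1 + m * (x3 - x1))" using n(1) yS by algebra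
    have "(x3 - xS) * ((x3 - x1) * (x3 - x2)) = 0"
      using E(1,3) m y3 xS unfolding Affine_in_E by algebra
    then have "x3 = x1 \<or> x3 = x2" using S(2) by auto
    then show False using y3 ne(2,3) m(1) by auto
  qed
  have k: "y3 + (y1 + m * (x3 - x1)) = k * (x3 - xS)"
    using n(1) yS k_def by algebra
  have sum34: "x3 + x4 = x1 + x2 - 2 * k * m + k ^ 2"
    using x4_def xS k_def by algebra
  have "(x3 - xS) * ((x3 - x1) * (x3 - x2) + k * (y1 + m * (x3 - x1) - y3)) = 0"
    using E(1,3) m k xS unfolding Affine_in_E by algebra
  then have "(x3 - x1) * (x3 - x2) + k * (y1 + m * (x3 - x1) - y3) = 0" using S(2) by simp
  then have prod34: "x3 * x4 = x1 * x2 + 2 * k * (y1 - m * x1) + k ^ 2 * xS"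
    using sum34 k by algebra
  define \<nu> where "\<nu> = 1 / k"
  have \<nu>: "\<nu> * k = 1" "\<nu> \<noteq> 0" using k0 by (auto simp: \<nu>_def)
  define \<beta> \<gamma> where "\<beta> = m - \<nu> * (x1 + x2)" and "\<gamma> = y1 - m * x1 + \<nu> * x1 * x2"
  \<comment> \<open>Each elementary symmetric function of the four zeros is a quadratic polynomial
    in \<open>k\<close>; this turns \<open>\<nu> ^ 2\<close> times it into a polynomial in
    \<open>\<nu>\<close>, so that the remaining identities are division-free.\<close>
  have red: "\<nu> ^ 2 * (A + k * B + k ^ 2 * C) = \<nu> ^ 2 * A + \<nu> * B + C" for A B C
    using \<nu>(1) by algebra
  have "on_parabola (\<nu>, \<beta>, \<gamma>) x1 x2 x3 x4"
    unfolding on_parabola_def prod.case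
  proof (intro conjI)
    show "\<nu> \<noteq> 0" by fact
    have e1: "x1 + x2 + x3 + x4 = 2 * (x1 + x2) + k * (- 2 * m) + k ^ 2 * 1"
      using sum34 by algebra
    show "1 - 2 * \<nu> * \<beta> = \<nu> ^ 2 * (x1 + x2 + x3 + x4)"
      unfolding e1 red \<beta>_def by algebra
    have e2: "x1 * x2 + x1 * x3 + x1 * x4 + x2 * x3 + x2 * x4 + x3 * x4 =
        (2 * x1 * x2 + (x1 + x2) ^ 2) + k * (2 * (y1 - m * x1) - 2 * m * (x1 + x2)) +
        k ^ 2 * m ^ 2"
      using sum34 prod34 xS by algebra
    show "\<beta> ^ 2 + 2 * \<nu> * \<gamma> =
        \<nu> ^ 2 * (x1 * x2 + x1 * x3 + x1 * x4 + x2 * x3 + x2 * x4 + x3 * x4)"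
      unfolding e2 red \<beta>_def \<gamma>_def by algebra
    have e3: "x1 * x2 * x3 + x1 * x2 * x4 + x1 * x3 * x4 + x2 * x3 * x4 =
        (x1 * x2 * (x1 + x2) + (x1 + x2) * (x1 * x2)) +
        k * (2 * (x1 + x2) * (y1 - m * x1) - 2 * m * (x1 * x2)) +
        k ^ 2 * (x1 * x2 + (x1 + x2) * xS)"
      using sum34 prod34 by algebra
    show "a - 2 * \<beta> * \<gamma> =
        \<nu> ^ 2 * (x1 * x2 * x3 + x1 * x2 * x4 + x1 * x3 * x4 + x2 * x3 * x4)"
      unfolding e3 red \<beta>_def \<gamma>_def xS using m by algebra
    have e4: "x1 * x2 * x3 * x4 =
        (x1 * x2) ^ 2 + k * (2 * (x1 * x2) * (y1 - m * x1)) + k ^ 2 * (x1 * x2 * xS)"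
      using prod34 by algebra
    show "b - \<gamma> ^ 2 = - (\<nu> ^ 2 * (x1 * x2 * x3 * x4))"
      unfolding e4 red \<gamma>_def xS using m E(1) unfolding Affine_in_E by algebra
  qed
  moreover have "y1 = \<nu> * x1 ^ 2 + \<beta> * x1 + \<gamma>" "y2 = \<nu> * x2 ^ 2 + \<beta> * x2 + \<gamma>"
    using m(1) \<beta>_def \<gamma>_def by algebra+
  moreover have "y3 = \<nu> * x3 ^ 2 + \<beta> * x3 + \<gamma>"
  proof -
    have "(x3 - x1) * (x3 - x2) = k * (y3 - (y1 + m * (x3 - x1)))"
      using sum34 prod34 k by algebra
    then have "\<nu> * ((x3 - x1) * (x3 - x2)) = y3 - (y1 + m * (x3 - x1))"
      using \<nu>(1) by algebra
    then show ?thesis unfolding \<beta>_def \<gamma>_def by algebra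
  qed
  moreover have "- y4 = \<nu> * x4 ^ 2 + \<beta> * x4 + \<gamma>"
  proof -
    have "- y4 + (y1 + m * (x4 - x1)) = k * (x4 - xS)"
      using y4_def yS k_def by algebra
    then have "(x4 - x1) * (x4 - x2) = k * (- y4 - (y1 + m * (x4 - x1)))"
      using sum34 prod34 by algebra
    then have "\<nu> * ((x4 - x1) * (x4 - x2)) = - y4 - (y1 + m * (x4 - x1))"
      using \<nu>(1) by algebra
    then show ?thesis unfolding \<beta>_def \<gamma>_def by algebra
  qed
  ultimately show ?thesis unfolding S(1) T by blast
qed

text \<open>At the double zero \<open>x1\<close> the derivative of \<open>x ^ 3 + a * x + b -
  (\<alpha> * x ^ 2 + \<beta> * x + \<gamma>) ^ 2\<close> vanishes.\<close>

lemma on_parabola_tangent: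
  assumes "on_parabola (\<alpha>, \<beta>, \<gamma>) x1 x1 x3 x4"
  shows "3 * x1 ^ 2 + a = 2 * (\<alpha> * x1 ^ 2 + \<beta> * x1 + \<gamma>) * (2 * \<alpha> * x1 + \<beta>)"
  using assms unfolding on_parabola_def by simp algebra

text \<open>Three distinct first coordinates determine the parabola by interpolation. When the first
  two points coincide, tangency supplies the missing condition; there \<open>y1\<close> is not 0, so
  the slope of the parabola is determined.\<close>

lemma on_parabola_unique:
  assumes "on_parabola (\<alpha>, \<beta>, \<gamma>) x1 x2 x3 x4" "on_parabola (\<alpha>', \<beta>', \<gamma>') x1 x2 x3 x4'"
    and y: "y1 = \<alpha> * x1 ^ 2 + \<beta> * x1 + \<gamma>" "y2 = \<alpha> * x2 ^ 2 + \<beta> * x2 + \<gamma>"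
      "y3 = \<alpha> * x3 ^ 2 + \<beta> * x3 + \<gamma>"
    and y': "y1 = \<alpha>' * x1 ^ 2 + \<beta>' * x1 + \<gamma>'" "y2 = \<alpha>' * x2 ^ 2 + \<beta>' * x2 + \<gamma>'"
      "y3 = \<alpha>' * x3 ^ 2 + \<beta>' * x3 + \<gamma>'"
    and "x1 \<noteq> x3" "x2 \<noteq> x3" "\<not> (x1 = x2 \<and> y1 = - y2)"
  shows "\<alpha> = \<alpha>' \<and> \<beta> = \<beta>' \<and> \<gamma> = \<gamma>' \<and> x4 = x4'"
proof -
  define u v where "u = \<alpha> - \<alpha>'" and "v = \<beta> - \<beta>'"
  have *: "(x1 - x3) * (u * (x1 + x3) + v) = 0" "(x2 - x3) * (u * (x2 + x3) + v) = 0"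
    "(x1 - x2) * (u * (x1 + x2) + v) = 0"
    using y y' u_def v_def by algebra+
  have uv: "u * (x1 + x3) + v = 0" "u * (x2 + x3) + v = 0" using * assms(9,10) by auto
  have "u = 0"
  proof (cases "x1 = x2")
    case True
    have "y1 = y2" using True y(1,2) by simp
    then have y1: "y1 \<noteq> 0" using True assms(11) by auto
    have "2 * y1 * (2 * u * x1 + v) = 0"
      using on_parabola_tangent[of \<alpha> \<beta> \<gamma> x1 x3 x4]
        on_parabola_tangent[of \<alpha>' \<beta>' \<gamma>' x1 x3 x4'] assms(1,2)
      unfolding True[symmetric] y(1)[symmetric] y'(1)[symmetric] u_def v_def by algebra
    then have "2 * u * x1 + v = 0" using y1 two_neq_0 by simp
    with uv(1) have "u * (x1 - x3) = 0" by algebra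
    then show ?thesis using assms(9) by simp
  next
    case False
    have "u * (x1 - x2) = 0" using uv by algebra
    then show ?thesis using False by simp
  qed
  moreover from this uv have "v = 0" by simp
  ultimately have eq: "\<alpha> = \<alpha>'" "\<beta> = \<beta>'" by (simp_all add: u_def v_def)
  with y(1) y'(1) have "\<gamma> = \<gamma>'" by simp
  moreover have "x4 = x4'"
    using assms(1,2) unfolding on_parabola_def eq by auto
  ultimately show ?thesis using eq by simp
qed

lemma on_parabola_rotate:
  "on_parabola c x2 x3 x1 x4 \<longleftrightarrow> on_parabola c x1 x2 x3 x4"
proof -
  have "x2 + x3 + x1 + x4 = x1 + x2 + x3 + x4"
    "x2 * x3 + x2 * x1 + x2 * x4 + x3 * x1 + x3 * x4 + x1 * x4 =
      x1 * x2 + x1 * x3 + x1 * x4 + x2 * x3 + x2 * x4 + x3 * x4"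
    "x2 * x3 * x1 + x2 * x3 * x4 + x2 * x1 * x4 + x3 * x1 * x4 =
      x1 * x2 * x3 + x1 * x2 * x4 + x1 * x3 * x4 + x2 * x3 * x4"
    "x2 * x3 * x1 * x4 = x1 * x2 * x3 * x4"
    by algebra+
  then show ?thesis by (cases c) (simp only: on_parabola_def prod.case)
qed

lemma add_assoc_generic:
  assumes E: "Affine x1 y1 \<in> E" "Affine x2 y2 \<in> E" "Affine x3 y3 \<in> E"
    and ne: "\<not> (x1 = x2 \<and> y1 = - y2)" "x1 \<noteq> x3" "x2 \<noteq> x3"
    and S: "Affine x1 y1 \<oplus> Affine x2 y2 = Affine xS yS" "xS \<noteq> x3"
    and T: "Affine x2 y2 \<oplus> Affine x3 y3 = Affine xT yT" "xT \<noteq> x1"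
  shows "Affine x1 y1 \<oplus> Affine x2 y2 \<oplus> Affine x3 y3 =
    Affine x1 y1 \<oplus> (Affine x2 y2 \<oplus> Affine x3 y3)"
proof -
  obtain \<alpha> \<beta> \<gamma> x4 y4 where 1: "Affine x1 y1 \<oplus> Affine x2 y2 \<oplus> Affine x3 y3 = Affine x4 y4"
    "on_parabola (\<alpha>, \<beta>, \<gamma>) x1 x2 x3 x4"
    "y1 = \<alpha> * x1 ^ 2 + \<beta> * x1 + \<gamma>" "y2 = \<alpha> * x2 ^ 2 + \<beta> * x2 + \<gamma>"
    "y3 = \<alpha> * x3 ^ 2 + \<beta> * x3 + \<gamma>" "- y4 = \<alpha> * x4 ^ 2 + \<beta> * x4 + \<gamma>"
    using add_add_on_parabola[OF E ne(1) _ _ S] ne(2,3) by blast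
  have ne': "\<not> (x2 = x3 \<and> y2 = - y3)" "Affine x1 y1 \<noteq> Affine x2 (- y2)"
    "Affine x1 y1 \<noteq> Affine x3 (- y3)"
    using ne by auto
  obtain \<alpha>' \<beta>' \<gamma>' x4' y4' where 2:
    "Affine x2 y2 \<oplus> Affine x3 y3 \<oplus> Affine x1 y1 = Affine x4' y4'"
    "on_parabola (\<alpha>', \<beta>', \<gamma>') x2 x3 x1 x4'"
    "y2 = \<alpha>' * x2 ^ 2 + \<beta>' * x2 + \<gamma>'" "y3 = \<alpha>' * x3 ^ 2 + \<beta>' * x3 + \<gamma>'"
    "y1 = \<alpha>' * x1 ^ 2 + \<beta>' * x1 + \<gamma>'" "- y4' = \<alpha>' * x4' ^ 2 + \<beta>' * x4' + \<gamma>'"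
    using add_add_on_parabola[OF E(2,3,1) ne' T] by blast
  have "\<alpha> = \<alpha>' \<and> \<beta> = \<beta>' \<and> \<gamma> = \<gamma>' \<and> x4 = x4'"
    using on_parabola_unique[OF 1(2) _ 1(3,4,5) 2(5,3,4)] 2(2) ne on_parabola_rotate by blast
  moreover from this 1(6) 2(6) have "y4 = y4'" by (metis minus_minus)
  ultimately show ?thesis
    using 1(1) 2(1) ec_add_commute ec_add_closed E by metis
qed

section \<open>From generic to arbitrary points\<close>

lemma infinite_UNIV_alg_closed: "infinite (UNIV :: 'a set)"
proof
  assume fin: "finite (UNIV :: 'a set)"
  define g :: "'a poly" where "g = (\<Prod>c\<in>UNIV. [:- c, 1:])"
  have "degree g = (\<Sum>c\<in>(UNIV :: 'a set). degree [:- c, 1:])"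
    unfolding g_def by (rule degree_prod_eq_sum_degree) auto
  also have "\<dots> = card (UNIV :: 'a set)" by simp
  finally have "degree g > 0" using fin by (simp add: finite_UNIV_card_ge_0)
  then have "degree (g + 1) > 0" by (simp add: degree_add_eq_left)
  then obtain x where "poly (g + 1) x = 0" using alg_closed_imp_poly_has_root by blast
  moreover have "poly g x = 0" using fin by (auto simp: g_def poly_prod intro!: prod_zero)
  ultimately show False by simp
qed

text \<open>The degenerate cases of associativity follow from the generic one by adding a generic point.\<close>

definition almost_all :: "('a ec_point \<Rightarrow> bool) \<Rightarrow> bool" where
  "almost_all \<Phi> \<longleftrightarrow> finite {S \<in> E. \<not> \<Phi> S}"

lemma almost_all_conj:
  "almost_all \<Phi> \<Longrightarrow> almost_all \<Psi> \<Longrightarrow> almost_all (\<lambda>S. \<Phi> S \<and> \<Psi> S)"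
  unfolding almost_all_def
  by (rule finite_subset[of _ "{S \<in> E. \<not> \<Phi> S} \<union> {S \<in> E. \<not> \<Psi> S}"]) auto

lemma almost_all_mono:
  "almost_all \<Phi> \<Longrightarrow> (\<And>S. S \<in> E \<Longrightarrow> \<Phi> S \<Longrightarrow> \<Psi> S) \<Longrightarrow> almost_all \<Psi>"
  unfolding almost_all_def by (rule finite_subset[of _ "{S \<in> E. \<not> \<Phi> S}"]) auto

lemma almost_all_translate:
  assumes "almost_all \<Phi>" "R \<in> E"
  shows "almost_all (\<lambda>S. \<Phi> (R \<oplus> S))"
proof -
  have "inj_on (\<lambda>S. R \<oplus> S) {S \<in> E. \<not> \<Phi> (R \<oplus> S)}"
    using assms(2) by (auto intro!: inj_onI dest: ec_add_left_cancel)
  moreover have "(\<lambda>S. R \<oplus> S) ` {S \<in> E. \<not> \<Phi> (R \<oplus> S)} \<subseteq> {S \<in> E. \<not> \<Phi> S}"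
    using assms(2) by auto
  ultimately show ?thesis
    using assms(1) unfolding almost_all_def by (meson finite_imageD finite_subset)
qed

lemma point_over_exists:
  obtains y where "Affine x y \<in> E"
  using nth_root_exists[of 2 "x ^ 3 + a * x + b"] by auto

lemma finite_points_over: "finite {S \<in> E. \<exists>y. S = Affine x y}"
proof -
  obtain y where y: "Affine x y \<in> E" by (rule point_over_exists)
  have "{S \<in> E. \<exists>y. S = Affine x y} \<subseteq> {Affine x y, Affine x (- y)}"
    using y power2_eq_iff[of _ y] by fastforce
  then show ?thesis by (rule finite_subset) simp
qed

lemma almost_all_x_neq: "almost_all (\<lambda>S. \<exists>x' y'. S = Affine x' y' \<and> x' \<noteq> x)"
proof -
  have "S \<in> insert Infinity {S \<in> E. \<exists>y. S = Affine x y}"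
    if "S \<in> E" "\<not> (\<exists>x' y'. S = Affine x' y' \<and> x' \<noteq> x)" for S
    using that by (cases S) auto
  then show ?thesis
    unfolding almost_all_def
    by (intro finite_subset[OF _ finite.insertI[OF finite_points_over[of x]]]) blast
qed

lemma almost_all_ex:
  assumes "almost_all \<Phi>"
  obtains S where "S \<in> E" "\<Phi> S"
proof -
  define X where "X = (\<lambda>P. case P of Infinity \<Rightarrow> 0 | Affine x y \<Rightarrow> x) ` E"
  have "x \<in> X" for x
  proof -
    obtain y where "Affine x y \<in> E" by (rule point_over_exists)
    then show ?thesis by (auto simp: X_def image_iff split: ec_point.split intro!: bexI)
  qed
  then have "infinite X" using infinite_UNIV_alg_closed by (metis UNIV_eq_I)
  then have "infinite E" unfolding X_def by (metis finite_imageI)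
  then have "\<not> E \<subseteq> {S \<in> E. \<not> \<Phi> S}"
    using assms unfolding almost_all_def by (meson finite_subset)
  then show ?thesis using that by blast
qed

lemma almost_all_assoc:
  assumes PQ: "P \<in> E" "Q \<in> E"
  shows "almost_all (\<lambda>S. P \<oplus> Q \<oplus> S = P \<oplus> (Q \<oplus> S))"
proof (cases "P = Infinity \<or> Q = Infinity \<or> P = ec_neg Q")
  case True
  have "ec_neg Q \<oplus> (Q \<oplus> S) = S" if "S \<in> E" for S
    using ec_add_eq_iff[of "ec_neg Q" "Q \<oplus> S" S] PQ that ec_add_commute by simp
  then show ?thesis
    using True by (auto simp: almost_all_def intro!: finite_subset[of _ "{}"])
next
  case False
  then obtain x1 y1 x2 y2 where eq: "P = Affine x1 y1" "Q = Affine x2 y2"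
    by (metis ec_point.exhaust)
  have ne: "\<not> (x1 = x2 \<and> y1 = - y2)" using False eq by auto
  obtain xS yS where S: "P \<oplus> Q = Affine xS yS"
    using slope_exists[of x1 y1 x2 y2] ec_add_Affine ne PQ unfolding eq by metis
  have "almost_all (\<lambda>R. ((\<exists>x y. R = Affine x y \<and> x \<noteq> x1) \<and> (\<exists>x y. R = Affine x y \<and> x \<noteq> x2)) \<and>
      (\<exists>x y. R = Affine x y \<and> x \<noteq> xS) \<and> (\<exists>x y. Q \<oplus> R = Affine x y \<and> x \<noteq> x1))"
    using almost_all_translate[OF almost_all_x_neq PQ(2)]
    by (intro almost_all_conj almost_all_x_neq)
  then show ?thesis
  proof (rule almost_all_mono)
    fix R assume "R \<in> E" and *: "((\<exists>x y. R = Affine x y \<and> x \<noteq> x1) \<and> (\<exists>x y. R = Affine x y \<and> x \<noteq> x2)) \<and>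
      (\<exists>x y. R = Affine x y \<and> x \<noteq> xS) \<and> (\<exists>x y. Q \<oplus> R = Affine x y \<and> x \<noteq> x1)"
    then obtain x3 y3 xT yT where "R = Affine x3 y3" "x1 \<noteq> x3" "x2 \<noteq> x3" "xS \<noteq> x3"
      "Q \<oplus> R = Affine xT yT" "xT \<noteq> x1" by auto
    then show "P \<oplus> Q \<oplus> R = P \<oplus> (Q \<oplus> R)"
      using add_assoc_generic[of x1 y1 x2 y2 x3 y3 xS yS xT yT] PQ \<open>R \<in> E\<close> ne S
      unfolding eq by blast
  qed
qed

text \<open>Both sides are added to a generic \<open>S\<close>. Every rebracketing then ends in
  \<open>S\<close> or in the sum of \<open>R\<close> and \<open>S\<close>, so it is one that holds
  for almost all \<open>S\<close>; at the end \<open>S\<close> is cancelled.\<close>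

theorem ec_add_assoc:
  assumes "P \<in> E" "Q \<in> E" "R \<in> E"
  shows "P \<oplus> Q \<oplus> R = P \<oplus> (Q \<oplus> R)"
proof -
  have "almost_all (\<lambda>S. (P \<oplus> Q \<oplus> R \<oplus> S = P \<oplus> Q \<oplus> (R \<oplus> S) \<and>
      P \<oplus> Q \<oplus> (R \<oplus> S) = P \<oplus> (Q \<oplus> (R \<oplus> S))) \<and>
      Q \<oplus> R \<oplus> S = Q \<oplus> (R \<oplus> S) \<and> P \<oplus> (Q \<oplus> R) \<oplus> S = P \<oplus> (Q \<oplus> R \<oplus> S))"
    using assms almost_all_translate[OF almost_all_assoc[OF assms(1,2)] assms(3)]
    by (intro almost_all_conj almost_all_assoc ec_add_closed) auto
  then obtain S where "S \<in> E" "P \<oplus> Q \<oplus> R \<oplus> S = P \<oplus> (Q \<oplus> R) \<oplus> S"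
    by (rule almost_all_ex) metis
  then show ?thesis
    using ec_add_right_cancel[of "P \<oplus> Q \<oplus> R" "P \<oplus> (Q \<oplus> R)" S] assms by simp
qed

end

subsection \<open>Multiplication by \<open>n\<close>\<close>

text \<open>A formal leading coefficient that is allowed to be 0. This matters because the
  coefficient \<open>n ^ 2\<close> of the denominators vanishes for \<open>n = p\<close>, so that
  true degrees could not be followed through the recursion.\<close>

definition bounded_coeff :: "'a::comm_ring_1 poly \<Rightarrow> nat \<Rightarrow> 'a \<Rightarrow> bool" where
  "bounded_coeff f n c \<longleftrightarrow> degree f \<le> n \<and> coeff f n = c"

lemma bounded_coeff_add:
  "bounded_coeff f n c \<Longrightarrow> bounded_coeff g n d \<Longrightarrow> bounded_coeff (f + g) n (c + d)"
  by (simp add: bounded_coeff_def degree_add_le)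

lemma bounded_coeff_diff:
  "bounded_coeff f n c \<Longrightarrow> bounded_coeff g n d \<Longrightarrow> bounded_coeff (f - g) n (c - d)"
  by (simp add: bounded_coeff_def degree_diff_le)

lemma bounded_coeff_mult:
  assumes "bounded_coeff f m c" "bounded_coeff g n d"
  shows "bounded_coeff (f * g) (m + n) (c * d)"
proof -
  have "degree (f * g) \<le> m + n"
    using assms degree_mult_le[of f g] by (simp add: bounded_coeff_def)
  moreover have "coeff (f * g) (m + n) = (\<Sum>i\<le>m + n. if i = m then c * d else 0)"
    unfolding coeff_mult
  proof (rule sum.cong)
    fix i assume "i \<in> {..m + n}"
    show "coeff f i * coeff g (m + n - i) = (if i = m then c * d else 0)"
      using assms coeff_eq_0[of f i] coeff_eq_0[of g "m + n - i"]
      by (cases "i < m"; cases "i = m") (auto simp: bounded_coeff_def)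
  qed simp
  ultimately show ?thesis by (simp add: bounded_coeff_def)
qed

lemma bounded_coeff_smult:
  "bounded_coeff f n c \<Longrightarrow> bounded_coeff (smult k f) n (k * c)"
  using degree_smult_le[of k f] by (auto simp: bounded_coeff_def)

lemma bounded_coeff_pCons_cancel:
  "bounded_coeff (pCons 0 f) (Suc n) c \<Longrightarrow> bounded_coeff f n c"
  by (cases "f = 0") (auto simp: bounded_coeff_def)

lemma bounded_coeff_cong:
  "bounded_coeff f m c \<Longrightarrow> f = g \<Longrightarrow> m = n \<Longrightarrow> c = d \<Longrightarrow> bounded_coeff g n d"
  by simp

context short_weierstrass
begin

abbreviation mult (infixr "\<odot>" 70) where "n \<odot> P \<equiv> ec_mult a n P"

lemma ec_mult_0 [simp]: "0 \<odot> P = Infinity"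
  by (simp add: ec_mult_def)

lemma ec_mult_Suc: "Suc n \<odot> P = P \<oplus> n \<odot> P"
  by (simp add: ec_mult_def)

lemma ec_mult_1 [simp]: "1 \<odot> P = P" "Suc 0 \<odot> P = P"
  by (simp_all add: ec_mult_Suc)

lemma ec_mult_Infinity [simp]: "n \<odot> Infinity = Infinity"
  by (induction n) (simp_all add: ec_mult_Suc)

lemma ec_mult_closed [simp]: "P \<in> E \<Longrightarrow> n \<odot> P \<in> E"
  by (induction n) (simp_all add: ec_mult_Suc)

lemma ec_mult_add: "P \<in> E \<Longrightarrow> (m + n) \<odot> P = m \<odot> P \<oplus> n \<odot> P"
  by (induction m) (simp_all add: ec_mult_Suc ec_add_assoc)

lemma ec_mult_mult: "P \<in> E \<Longrightarrow> (m * n) \<odot> P = m \<odot> n \<odot> P"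
  by (induction m) (simp_all add: ec_mult_Suc ec_mult_add)

lemma ec_add_left_commute:
  assumes "P \<in> E" "Q \<in> E" "R \<in> E"
  shows "P \<oplus> (Q \<oplus> R) = Q \<oplus> (P \<oplus> R)"
  using ec_add_assoc[OF assms] ec_add_assoc[OF assms(2,1,3)] ec_add_commute[OF assms(1,2)]
  by simp

lemma ec_mult_add_distrib:
  assumes "P \<in> E" "Q \<in> E"
  shows "n \<odot> (P \<oplus> Q) = n \<odot> P \<oplus> n \<odot> Q"
proof (induction n)
  case (Suc n)
  have "P \<oplus> Q \<oplus> (n \<odot> P \<oplus> n \<odot> Q) = P \<oplus> n \<odot> P \<oplus> (Q \<oplus> n \<odot> Q)"
    using assms ec_add_left_commute[of Q "n \<odot> P" "n \<odot> Q"] by (simp add: ec_add_assoc)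
  then show ?case using Suc by (simp add: ec_mult_Suc)
qed simp

lemma ec_neg_unique:
  assumes "P \<in> E" "Q \<in> E" "P \<oplus> Q = Infinity"
  shows "Q = ec_neg P"
  using ec_add_eq_iff[of P Q Infinity] assms by simp

lemma ec_mult_neg:
  assumes "P \<in> E"
  shows "n \<odot> ec_neg P = ec_neg (n \<odot> P)"
proof (rule ec_neg_unique)
  have "n \<odot> P \<oplus> n \<odot> ec_neg P = n \<odot> (P \<oplus> ec_neg P)"
    using assms by (simp only: ec_mult_add_distrib ec_neg_in_E)
  then show "n \<odot> P \<oplus> n \<odot> ec_neg P = Infinity" by simp
qed (use assms in simp_all)

text \<open>\<open>(X : Z)\<close> are homogeneous coordinates of the image of \<open>P\<close> on the projective \<open>x\<close>-line.\<close>

definition xrep :: "'a ec_point \<Rightarrow> 'a \<Rightarrow> 'a \<Rightarrow> bool" where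
  "xrep P X Z \<longleftrightarrow> (case P of Infinity \<Rightarrow> X \<noteq> 0 \<and> Z = 0 | Affine x y \<Rightarrow> Z \<noteq> 0 \<and> X = x * Z)"

lemma xrep_simps [simp]:
  "xrep Infinity X Z \<longleftrightarrow> X \<noteq> 0 \<and> Z = 0"
  "xrep (Affine x y) X Z \<longleftrightarrow> Z \<noteq> 0 \<and> X = x * Z"
  by (simp_all add: xrep_def)

text \<open>\<open>xrep\<close> includes that the two coordinates are not both 0. At a point of
  order 2 the new \<open>Z\<close> is 0, and the new \<open>X\<close> is not, by smoothness. Proving
  this pointwise replaces any coprimality argument for numerator and denominator
  polynomials.\<close>

lemma xrep_double:
  assumes "P \<in> E" "xrep P X Z"
  shows "xrep (P \<oplus> P) ((X ^ 2 - a * Z ^ 2) ^ 2 - 8 * b * X * Z ^ 3)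
    (4 * (X ^ 3 * Z + a * X * Z ^ 3 + b * Z ^ 4))"
proof (cases P)
  case Infinity
  then show ?thesis using assms by simp
next
  case (Affine x y)
  then have X: "X = x * Z" "Z \<noteq> 0" and y: "y ^ 2 = x ^ 3 + a * x + b" using assms by auto
  have Z': "4 * (X ^ 3 * Z + a * X * Z ^ 3 + b * Z ^ 4) = (2 * y * Z ^ 2) ^ 2"
    unfolding X y power_mult_distrib by algebra
  have X': "(X ^ 2 - a * Z ^ 2) ^ 2 - 8 * b * X * Z ^ 3 =
      (3 * x ^ 2 + a) ^ 2 * Z ^ 4 - 2 * x * (2 * y * Z ^ 2) ^ 2"
    unfolding X y power_mult_distrib by algebra
  show ?thesis
  proof (cases "y = 0")
    case True
    then have "3 * x ^ 2 + a \<noteq> 0" using y smooth by simp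
    then show ?thesis unfolding X' Z' using Affine True X(2) by simp
  next
    case False
    obtain m where m: "y = y + m * (x - x)" "m * (y + y) = x ^ 2 + x * x + x ^ 2 + a"
      using slope_exists[of x y x y] assms(1) Affine False eq_uminus_self_iff by metis
    have "P \<oplus> P = Affine (m ^ 2 - x - x) (- (y + m * (m ^ 2 - x - x - x)))"
      unfolding Affine by (rule ec_add_Affine[OF m]) (use False eq_uminus_self_iff in blast)
    moreover have "(3 * x ^ 2 + a) ^ 2 * Z ^ 4 - 2 * x * (2 * y * Z ^ 2) ^ 2 =
        (m ^ 2 - x - x) * (2 * y * Z ^ 2) ^ 2"
      using m(2) by algebra
    ultimately show ?thesis unfolding X' Z' using False X(2) two_neq_0 by simp
  qed
qed

text \<open>Differential addition: the first coordinates of the sum and of the difference have a sum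
  that is rational in the first coordinates of the two points. Applied to consecutive multiples,
  whose difference is the point itself, it gives odd multiples without second coordinates.\<close>

lemma xrep_diff_add:
  assumes "P \<in> E" "Q \<in> E" "P \<oplus> ec_neg Q = Affine x y" "xrep P X1 Z1" "xrep Q X2 Z2"
  shows "xrep (P \<oplus> Q)
    (2 * ((X1 * Z2 + X2 * Z1) * (a * (Z1 * Z2) + X1 * X2) + 2 * b * (Z1 * Z2) ^ 2) -
      x * (X1 * Z2 - X2 * Z1) ^ 2)
    ((X1 * Z2 - X2 * Z1) ^ 2)"
proof (cases "P = Infinity \<or> Q = Infinity")
  case True
  moreover have "Q = Affine x (- y)" if "P = Infinity"
    using assms(3) that by (cases Q) auto
  ultimately show ?thesis using assms(3-5)
    by (auto simp: power_mult_distrib power2_eq_square mult_2 algebra_simps)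
next
  case False
  then obtain x1 y1 x2 y2 where PQ: "P = Affine x1 y1" "Q = Affine x2 y2"
    by (metis ec_point.exhaust)
  have X: "X1 = x1 * Z1" "X2 = x2 * Z2" "Z1 \<noteq> 0" "Z2 \<noteq> 0" using assms(4,5) PQ by auto
  have y: "y1 ^ 2 = x1 ^ 3 + a * x1 + b" "y2 ^ 2 = x2 ^ 3 + a * x2 + b" using assms(1,2) PQ by auto
  have D: "(X1 * Z2 - X2 * Z1) ^ 2 = (x1 - x2) ^ 2 * (Z1 * Z2) ^ 2" unfolding X by algebra
  have N: "2 * ((X1 * Z2 + X2 * Z1) * (a * (Z1 * Z2) + X1 * X2) + 2 * b * (Z1 * Z2) ^ 2) =
      2 * ((x1 + x2) * (a + x1 * x2) + 2 * b) * (Z1 * Z2) ^ 2" unfolding X by algebra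
  show ?thesis
  proof (cases "x1 = x2")
    case True
    have "y1 = y2 \<or> y1 = - y2" using y True by (simp flip: power2_eq_iff)
    moreover have "y1 \<noteq> y2" using assms(3) PQ True by auto
    ultimately have *: "y1 = - y2" "y1 \<noteq> 0" by auto
    have "2 * ((x1 + x2) * (a + x1 * x2) + 2 * b) = (2 * y1) ^ 2"
      using y(1) True by algebra
    moreover have "2 * y1 * (Z1 * Z2) \<noteq> 0" using *(2) two_neq_0 X(3,4) by simp
    then have "(2 * y1) ^ 2 * (Z1 * Z2) ^ 2 \<noteq> 0"
      unfolding power_mult_distrib[symmetric] by (rule power_not_zero)
    moreover have "P \<oplus> Q = Infinity" using * True PQ by simp
    ultimately show ?thesis unfolding N D True by (simp only: xrep_simps) simp
  next
    case False
    obtain m where m: "y2 = y1 + m * (x2 - x1)" "m * (y1 + y2) = x1 ^ 2 + x1 * x2 + x2 ^ 2 + a"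
      using slope_exists[of x1 y1 x2 y2] assms(1,2) PQ False by metis
    have y2: "Affine x2 (- y2) \<in> E" using y by simp
    obtain n where n: "- y2 = y1 + n * (x2 - x1)" "n * (y1 + - y2) = x1 ^ 2 + x1 * x2 + x2 ^ 2 + a"
      using slope_exists[of x1 y1 x2 "- y2"] assms(1) y2 PQ False by metis
    have s: "P \<oplus> Q = Affine (m ^ 2 - x1 - x2) (- (y1 + m * (m ^ 2 - x1 - x2 - x1)))"
      unfolding PQ by (rule ec_add_Affine[OF m]) (use False in blast)
    have "P \<oplus> ec_neg Q = Affine (n ^ 2 - x1 - x2) (- (y1 + n * (n ^ 2 - x1 - x2 - x1)))"
      unfolding PQ ec_neg.simps by (rule ec_add_Affine[OF n]) (use False in blast)
    with assms(3) have x: "x = n ^ 2 - x1 - x2" by simp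
    have *: "2 * ((x1 + x2) * (a + x1 * x2) + 2 * b) = (m ^ 2 - x1 - x2 + x) * (x1 - x2) ^ 2"
    proof -
      have "(m * (x2 - x1)) ^ 2 + (n * (x2 - x1)) ^ 2 = 2 * y1 ^ 2 + 2 * y2 ^ 2"
        using m(1) n(1) by algebra
      then show ?thesis unfolding x y by algebra
    qed
    show ?thesis
      unfolding N D s xrep_simps *
    proof
      show "(x1 - x2) ^ 2 * (Z1 * Z2) ^ 2 \<noteq> 0" using False X by simp
    qed algebra
  qed
qed


text \<open>The first coordinate of multiplication by \<open>n\<close> is \<open>F / G\<close>. Over a field of
  characteristic zero, \<open>G\<close> would have degree \<open>n\<^sup>2 - 1\<close> and leading coefficient \<open>n\<^sup>2\<close>; multiplying
  by \<open>X\<close> avoids the truncated subtraction.\<close>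

definition mult_polys :: "nat \<Rightarrow> 'a poly \<Rightarrow> 'a poly \<Rightarrow> bool" where
  "mult_polys n F G \<longleftrightarrow> bounded_coeff F (n ^ 2) 1 \<and>
     bounded_coeff (pCons 0 G) (n ^ 2) (of_nat (n ^ 2)) \<and>
     (\<forall>x y. Affine x y \<in> E \<longrightarrow> xrep (n \<odot> Affine x y) (poly F x) (poly G x))"

lemma bounded_coeff_pCons_0:
  "bounded_coeff (pCons 0 G) n c \<Longrightarrow> bounded_coeff G n (0 :: 'a)"
  by (cases "G = 0") (auto simp: bounded_coeff_def coeff_eq_0)

lemma mult_polys_double:
  assumes "mult_polys n F G"
  shows "mult_polys (2 * n) ((F ^ 2 - smult a (G ^ 2)) ^ 2 - smult (8 * b) (F * G ^ 3))
    (smult 4 (F ^ 3 * G + smult a (F * G ^ 3) + smult b (G ^ 4)))"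
    (is "mult_polys _ ?F ?G")
proof -
  define N where "N = n ^ 2"
  define H where "H = pCons 0 G"
  have F: "bounded_coeff F N 1" and H: "bounded_coeff H N (of_nat N)"
    using assms by (auto simp: mult_polys_def N_def H_def)
  from H have G: "bounded_coeff G N 0" unfolding H_def by (rule bounded_coeff_pCons_0)
  note bc = bounded_coeff_add bounded_coeff_diff bounded_coeff_mult bounded_coeff_smult F G H
  have "bounded_coeff ((F * F - smult a (G * G)) * (F * F - smult a (G * G)) -
      smult (8 * b) ((F * G) * (G * G))) ((N + N) + (N + N)) ((1 * 1 - a * (0 * 0)) * (1 * 1 - a * (0 * 0)) -
      (8 * b) * ((1 * 0) * (0 * 0)))"
    by (intro bc)
  then have 1: "bounded_coeff ?F ((2 * n) ^ 2) 1"
    by (rule bounded_coeff_cong) (simp_all add: N_def power2_eq_square power3_eq_cube mult.assoc)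
  have "bounded_coeff (smult 4 ((F * F) * (F * H) + smult a ((F * H) * (G * G)) +
      smult b ((H * G) * (G * G)))) ((N + N) + (N + N))
      (4 * ((1 * 1) * (1 * of_nat N) + a * ((1 * of_nat N) * (0 * 0)) + b * ((of_nat N * 0) * (0 * 0))))"
    by (intro bc)
  then have 2: "bounded_coeff (pCons 0 ?G) ((2 * n) ^ 2) (of_nat ((2 * n) ^ 2))"
  proof (rule bounded_coeff_cong)
    have X: "pCons 0 f = [:0, 1:] * f" for f :: "'a poly" by simp
    have H': "H = [:0, 1:] * G" by (simp add: H_def)
    show "smult 4 ((F * F) * (F * H) + smult a ((F * H) * (G * G)) +
      smult b ((H * G) * (G * G))) = pCons 0 ?G"
      unfolding H' X[of ?G]
      by (simp add: algebra_simps power2_eq_square power3_eq_cube power4_eq_xxxx del: mult_pCons_left)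
  qed (simp_all add: N_def power2_eq_square)
  have "xrep ((2 * n) \<odot> Affine x y) (poly ?F x) (poly ?G x)" if "Affine x y \<in> E" for x y
  proof -
    have "xrep (n \<odot> Affine x y) (poly F x) (poly G x)" using assms that by (simp add: mult_polys_def)
    from xrep_double[OF _ this] show ?thesis
      using that ec_mult_add[of "Affine x y" n n] by (simp add: mult_2 mult.assoc)
  qed
  with 1 2 show ?thesis unfolding mult_polys_def by blast
qed

lemma mult_polys_double_plus_1:
  assumes "mult_polys n F0 G0" "mult_polys (Suc n) F1 G1"
  shows "\<exists>F G. mult_polys (2 * n + 1) F G"
proof -
  define M N where "M = n ^ 2" and "N = Suc n ^ 2"
  define X :: "'a poly" where "X = [:0, 1:]"
  have X: "pCons 0 f = X * f" for f by (simp add: X_def)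
  have F: "bounded_coeff F0 M 1" "bounded_coeff F1 N 1"
    and H: "bounded_coeff (X * G0) M (of_nat M)" "bounded_coeff (X * G1) N (of_nat N)"
    using assms by (auto simp: mult_polys_def M_def N_def X)
  from H have G: "bounded_coeff G0 M 0" "bounded_coeff G1 N 0"
    unfolding X[symmetric] by (auto dest: bounded_coeff_pCons_0)
  note bc = bounded_coeff_add bounded_coeff_diff bounded_coeff_mult bounded_coeff_smult F G H
  define D where "D = F1 * G0 - F0 * G1"
  define F where "F = smult 2 ((F1 * G0 + F0 * G1) * (smult a (G1 * G0) + F1 * F0) +
    smult (2 * b) ((G1 * G0) * (G1 * G0))) - X * (D * D)"
  have "bounded_coeff (F1 * (X * G0) - (X * G1) * F0) (N + M) (1 * of_nat M - of_nat N * 1)"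
    by (intro bc)
  then have D: "bounded_coeff (X * D) (N + M) (of_nat M - of_nat N)"
    by (rule bounded_coeff_cong) (simp_all add: D_def algebra_simps)
  \<comment> \<open>The formulas have formal degree \<open>2 * (n ^ 2 + (n + 1) ^ 2)\<close>, one
    more than \<open>(2 * n + 1) ^ 2\<close>, so one factor \<open>X\<close> is cancelled at the
    end. The leading coefficients come out right because
    \<open>(n ^ 2 - (n + 1) ^ 2) ^ 2 = (2 * n + 1) ^ 2\<close> and
    \<open>2 * (n ^ 2 + (n + 1) ^ 2) - (2 * n + 1) ^ 2 = 1\<close>.\<close>
  have NM: "N + M + (N + M) = Suc ((2 * n + 1) ^ 2)"
    by (simp add: N_def M_def power2_eq_square)
  have sq: "(of_nat M - of_nat N) * (of_nat M - of_nat N) = (of_nat ((2 * n + 1) ^ 2) :: 'a)"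
    by (simp add: N_def M_def power2_eq_square algebra_simps)
  from bounded_coeff_mult[OF D D] have DD: "bounded_coeff (pCons 0 (pCons 0 (D * D)))
      (Suc ((2 * n + 1) ^ 2)) (of_nat ((2 * n + 1) ^ 2))"
    by (rule bounded_coeff_cong) (simp_all only: X NM sq, simp_all add: algebra_simps)
  have 2: "bounded_coeff (pCons 0 (D * D)) ((2 * n + 1) ^ 2) (of_nat ((2 * n + 1) ^ 2))"
    by (rule bounded_coeff_pCons_cancel[OF DD])
  have "bounded_coeff (smult 2 ((F1 * (X * G0) + (X * G1) * F0) * (smult a (G1 * G0) + F1 * F0) +
      smult (2 * b) ((G1 * G0) * ((X * G1) * G0))) - (X * D) * (X * D))
      (N + M + (N + M)) (2 * ((1 * of_nat M + of_nat N * 1) * (a * (0 * 0) + 1 * 1) +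
        2 * b * ((0 * 0) * (of_nat N * 0))) - (of_nat M - of_nat N) * (of_nat M - of_nat N))"
    by (intro bc D)
  then have "bounded_coeff (pCons 0 F) (Suc ((2 * n + 1) ^ 2)) 1"
  proof (rule bounded_coeff_cong)
    show "smult 2 ((F1 * (X * G0) + (X * G1) * F0) * (smult a (G1 * G0) + F1 * F0) +
      smult (2 * b) ((G1 * G0) * ((X * G1) * G0))) - (X * D) * (X * D) = pCons 0 F"
      unfolding X F_def by (simp add: algebra_simps)
  qed (simp_all only: NM sq, simp_all add: N_def M_def power2_eq_square algebra_simps)
  then have 1: "bounded_coeff F ((2 * n + 1) ^ 2) 1" by (rule bounded_coeff_pCons_cancel)
  have "xrep ((2 * n + 1) \<odot> Affine x y) (poly F x) (poly (D * D) x)" if "Affine x y \<in> E" for x y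
  proof -
    let ?P = "Affine x y"
    have "Suc n \<odot> ?P \<oplus> ec_neg (n \<odot> ?P) = ?P"
      unfolding ec_mult_Suc using that by (intro ec_add_neg_cancel) simp_all
    moreover have "xrep (n \<odot> ?P) (poly F0 x) (poly G0 x)" "xrep (Suc n \<odot> ?P) (poly F1 x) (poly G1 x)"
      using assms that by (simp_all add: mult_polys_def)
    ultimately have *: "xrep (Suc n \<odot> ?P \<oplus> n \<odot> ?P)
        (2 * ((poly F1 x * poly G0 x + poly F0 x * poly G1 x) *
          (a * (poly G1 x * poly G0 x) + poly F1 x * poly F0 x) +
          2 * b * (poly G1 x * poly G0 x) ^ 2) - x * (poly F1 x * poly G0 x - poly F0 x * poly G1 x) ^ 2)
        ((poly F1 x * poly G0 x - poly F0 x * poly G1 x) ^ 2)"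
      using that by (intro xrep_diff_add) simp_all
    have "Suc n \<odot> ?P \<oplus> n \<odot> ?P = (2 * n + 1) \<odot> ?P"
      using ec_mult_add[OF that, of "Suc n" n] by (simp add: mult_2)
    with * show ?thesis
      by (simp add: F_def D_def X_def power2_eq_square)
  qed
  with 1 2 show ?thesis unfolding mult_polys_def by blast
qed

lemma mult_polys_exist: "\<exists>F G. mult_polys n F G"
proof (induction n rule: less_induct)
  case (less n)
  consider "n = 0" | "n = 1" | k where "n = 2 * k" "k < n" | k where "n = 2 * k + 1" "Suc k < n"
  proof (cases "n \<le> 1")
    case False
    show ?thesis
    proof (cases "even n")
      case True
      then show ?thesis using that(3)[of "n div 2"] False by simp
    next
      case odd: False
      then have "n \<noteq> 2" by auto
      then show ?thesis using that(4)[of "n div 2"] False odd by simp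
    qed
  qed (use that(1,2) in fastforce)
  then show ?case
  proof cases
    case 1
    have "mult_polys 0 1 0" by (simp add: mult_polys_def bounded_coeff_def)
    then show ?thesis using 1 by blast
  next
    case 2
    have "mult_polys 1 [:0, 1:] 1" by (simp add: mult_polys_def bounded_coeff_def)
    then show ?thesis using 2 by blast
  next
    case 3
    then show ?thesis using less.IH mult_polys_double by metis
  next
    case 4
    then show ?thesis using less.IH[of k] less.IH[of "Suc k"] mult_polys_double_plus_1 by auto
  qed
qed

end

subsection \<open>Multiplication by \<open>p\<close> on supersingular curves\<close>

lemma poly_root_zero_only:
  fixes f :: "'a::alg_closed_field poly"
  assumes "f \<noteq> 0" "\<And>x. poly f x = 0 \<Longrightarrow> x = 0"
  shows "f = monom (lead_coeff f) (degree f)"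
proof -
  obtain A where A: "size A = degree f" "f = smult (lead_coeff f) (\<Prod>x\<in>#A. [:-x, 1:])"
    using alg_closed_imp_factorization[OF assms(1)] by blast
  have "x = 0" if "x \<in># A" for x
  proof (rule assms(2))
    have "poly (\<Prod>x\<in>#A. [:-x, 1:]) x = 0"
      using that by (auto simp: poly_prod_mset prod_mset_zero_iff)
    then show "poly f x = 0" using A(2) by (metis mult_zero_right poly_smult)
  qed
  then have "A = replicate_mset (size A) 0"
    by (metis set_mset_subset_singletonD singletonI subsetI)
  then have "(\<Prod>x\<in>#A. [:-x, 1:]) = [:0, 1:] ^ degree f"
    using A(1) by (metis image_replicate_mset minus_zero prod_mset_replicate_mset)
  with A(2) show ?thesis by (simp add: monom_altdef)
qed

context short_weierstrass
begin

lemma cubic_roots: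
  obtains e1 e2 e3 where "e1 + e2 + e3 = 0" "Affine e1 0 \<in> E" "Affine e2 0 \<in> E" "Affine e3 0 \<in> E"
proof -
  have "degree [:b, a, 0, 1:] > 0" by simp
  then obtain e1 where "poly [:b, a, 0, 1:] e1 = 0" using alg_closed_imp_poly_has_root by blast
  then have e1: "e1 ^ 3 + a * e1 + b = 0" by (simp add: algebra_simps power3_eq_cube)
  have "degree [:a + e1 ^ 2, e1, 1:] > 0" by simp
  then obtain e2 where "poly [:a + e1 ^ 2, e1, 1:] e2 = 0" using alg_closed_imp_poly_has_root by blast
  then have e2: "e2 ^ 2 + e1 * e2 + a + e1 ^ 2 = 0" by (simp add: algebra_simps power2_eq_square)
  have "e2 ^ 3 + a * e2 + b = 0" using e1 e2 by algebra
  moreover have "(- e1 - e2) ^ 3 + a * (- e1 - e2) + b = 0" using e1 e2 by algebra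
  ultimately show ?thesis using e1 by (intro that[of e1 e2 "- e1 - e2"]) simp_all
qed

lemma same_x:
  assumes "Affine x y \<in> E" "Affine x y' \<in> E"
  shows "Affine x y' = Affine x y \<or> Affine x y' = ec_neg (Affine x y)"
  using assms power2_eq_iff[of y' y] by auto

lemma two_torsion_odd_mult:
  assumes "Affine e 0 \<in> E" "odd n"
  shows "n \<odot> Affine e 0 = Affine e 0"
proof -
  obtain k where n: "n = Suc (k * 2)" using assms(2) by (metis Suc_eq_plus1 mult.commute oddE)
  have "2 \<odot> Affine e 0 = Infinity" by (simp add: numeral_2_eq_2 ec_mult_Suc)
  then show ?thesis using assms(1) by (simp only: n ec_mult_Suc ec_mult_mult ec_mult_Infinity ec_add_Infinity_right)
qed

text \<open>As \<open>G\<close> has no zero, it is constant; as multiplication by \<open>p\<close> is injective, \<open>F - F(0)\<close>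
  has no zero but 0, so that it is a power of \<open>X\<close>. Hence multiplication by \<open>p\<close> is purely inseparable.\<close>

theorem supersingular_mult_p:
  assumes "CHAR('a) = p" "prime p" "supersingular a b"
  obtains c where "c \<noteq> 0"
    "\<And>x y. Affine x y \<in> E \<Longrightarrow> \<exists>y'. p \<odot> Affine x y = Affine (x ^ p ^ 2 / c) y'"
proof -
  have tors: "P = Infinity" if "P \<in> E" "p \<odot> P = Infinity" for P
    using assms(1,3) that by (auto simp: supersingular_def ec_torsion_def)
  obtain F G where FG: "mult_polys p F G" using mult_polys_exist by blast
  then have rep: "xrep (p \<odot> Affine x y) (poly F x) (poly G x)" if "Affine x y \<in> E" for x y
    using that by (simp add: mult_polys_def)
  have "poly G x \<noteq> 0" for x
  proof
    assume "poly G x = 0"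
    obtain y where y: "Affine x y \<in> E" by (rule point_over_exists)
    have "p \<odot> Affine x y = Infinity"
      using rep[OF y] \<open>poly G x = 0\<close> by (cases "p \<odot> Affine x y") auto
    then show False using tors[OF y] by simp
  qed
  then have "degree G = 0" using alg_closed_imp_poly_has_root[of G] by blast
  then obtain c where G: "G = [:c:]" by (rule degree_eq_zeroE)
  then have c: "c \<noteq> 0" using \<open>poly G 0 \<noteq> 0\<close> by simp
  have mult_p: "\<exists>y'. p \<odot> Affine x y = Affine (poly F x / c) y'" if "Affine x y \<in> E" for x y
    using rep[OF that] c by (cases "p \<odot> Affine x y") (auto simp: G)
  have inj: "x1 = x2" if F_eq: "poly F x1 = poly F x2" for x1 x2
  proof -
    obtain y1 y2 where y: "Affine x1 y1 \<in> E" "Affine x2 y2 \<in> E"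
      using point_over_exists by metis
    obtain z1 z2 where z: "p \<odot> Affine x1 y1 = Affine (poly F x2 / c) z1"
      "p \<odot> Affine x2 y2 = Affine (poly F x2 / c) z2"
      using mult_p[OF y(1)] mult_p[OF y(2)] unfolding F_eq by blast
    have eq: "R = Affine x1 y1" if R: "R \<in> E" "p \<odot> R = p \<odot> Affine x1 y1" for R
    proof -
      have "p \<odot> (R \<oplus> ec_neg (Affine x1 y1)) = p \<odot> R \<oplus> ec_neg (p \<odot> Affine x1 y1)"
        using R(1) y(1) by (simp only: ec_mult_add_distrib ec_mult_neg ec_neg_in_E)
      then have "p \<odot> (R \<oplus> ec_neg (Affine x1 y1)) = Infinity" using R(2) by simp
      then have "R \<oplus> ec_neg (Affine x1 y1) = Infinity"
        using tors R(1) y(1) by (simp only: ec_add_closed ec_neg_in_E)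
      then have "ec_neg (Affine x1 y1) = ec_neg R"
        using ec_neg_unique R(1) y(1) ec_neg_in_E by blast
      then show ?thesis by (metis ec_neg_neg)
    qed
    have "p \<odot> Affine x2 y2 = p \<odot> Affine x1 y1 \<or> p \<odot> Affine x2 y2 = ec_neg (p \<odot> Affine x1 y1)"
      unfolding z using same_x ec_mult_closed y z by metis
    then have "Affine x2 y2 = Affine x1 y1 \<or> ec_neg (Affine x2 y2) = Affine x1 y1"
      using eq y(2) ec_mult_neg[OF y(2)] ec_neg_in_E[OF y(2)] by (metis ec_neg_neg)
    then show ?thesis by auto
  qed
  define d where "d = poly F 0"
  have deg: "degree F = p ^ 2" "lead_coeff F = 1"
  proof -
    have F: "degree F \<le> p ^ 2" "coeff F (p ^ 2) = 1"
      using FG by (auto simp: mult_polys_def bounded_coeff_def)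
    show "degree F = p ^ 2" using F le_degree[of F "p ^ 2"] by simp
    with F show "lead_coeff F = 1" by simp
  qed
  have "p ^ 2 > 0" using assms(2) prime_gt_0_nat by simp
  have deg': "degree (F - [:d:]) = p ^ 2" "lead_coeff (F - [:d:]) = 1"
  proof -
    show "degree (F - [:d:]) = p ^ 2"
      unfolding diff_conv_add_uminus using deg \<open>p ^ 2 > 0\<close> by (subst degree_add_eq_left) simp_all
    with \<open>p ^ 2 > 0\<close> deg show "lead_coeff (F - [:d:]) = 1"
      by (simp add: coeff_pCons split: nat.split)
  qed
  have "F - [:d:] = monom 1 (p ^ 2)"
  proof -
    have "F - [:d:] \<noteq> 0" using deg'(2) by (metis leading_coeff_0_iff zero_neq_one)
    moreover have "x = 0" if "poly (F - [:d:]) x = 0" for x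
      by (rule inj) (use that in \<open>simp add: d_def\<close>)
    ultimately have "F - [:d:] = monom (lead_coeff (F - [:d:])) (degree (F - [:d:]))"
      by (rule poly_root_zero_only)
    then show ?thesis unfolding deg'(2) unfolding deg'(1) .
  qed
  then have "poly (F - [:d:]) x = poly (monom 1 (p ^ 2)) x" for x by (simp only:)
  then have F: "poly F x = x ^ p ^ 2 + d" for x by (simp add: poly_monom diff_eq_eq)
  have "p \<noteq> 2"
  proof
    assume "p = 2"
    then have "of_nat 2 = (0::'a)" using assms(1) of_nat_CHAR by metis
    then show False using two_neq_0 by simp
  qed
  then have "odd p" using assms(2) primes_dvd_imp_eq two_is_prime_nat by blast
  \<comment> \<open>Multiplication by an odd number fixes the 2-torsion points. Added up over the
    three roots of the cubic, whose sum is 0, this relation leaves \<open>3 * d = 0\<close>, as the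
    Frobenius map is additive.\<close>
  have e: "e ^ p ^ 2 + d = c * e" if "Affine e 0 \<in> E" for e
  proof -
    have "poly F e / c = e"
      using mult_p[OF that] two_torsion_odd_mult[OF that \<open>odd p\<close>] by auto
    then show ?thesis using c F by (simp add: field_simps)
  qed
  obtain e1 e2 e3 where es: "e1 + e2 + e3 = 0" "Affine e1 0 \<in> E" "Affine e2 0 \<in> E" "Affine e3 0 \<in> E"
    by (rule cubic_roots)
  have "(e1 + e2 + e3) ^ p ^ 2 = e1 ^ p ^ 2 + e2 ^ p ^ 2 + e3 ^ p ^ 2"
    using freshmans_dream'[where 'a = 'a and m = "p ^ 2" and n = 2] assms(1,2) by simp
  then have "e1 ^ p ^ 2 + e2 ^ p ^ 2 + e3 ^ p ^ 2 = 0"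
    unfolding es(1) zero_power[OF \<open>p ^ 2 > 0\<close>] by (rule sym)
  moreover have "3 * d = (e1 ^ p ^ 2 + d) + (e2 ^ p ^ 2 + d) + (e3 ^ p ^ 2 + d) -
      (e1 ^ p ^ 2 + e2 ^ p ^ 2 + e3 ^ p ^ 2)"
    by simp
  ultimately have "3 * d = c * (e1 + e2 + e3)"
    unfolding e[OF es(2)] e[OF es(3)] e[OF es(4)] by (simp add: algebra_simps)
  then have "3 * d = 0" using es(1) by simp
  then have "d = 0" using three_neq_0 by simp
  show ?thesis
    by (rule that[OF c]) (use mult_p F \<open>d = 0\<close> in auto)
qed

end

subsection \<open>Isomorphisms and 2-isogenies\<close>

fun ec_scale :: "'a::field \<Rightarrow> 'a ec_point \<Rightarrow> 'a ec_point" where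
  "ec_scale t Infinity = Infinity"
| "ec_scale t (Affine x y) = Affine (t ^ 2 * x) (t ^ 3 * y)"

lemma ec_scale_scale_inverse: "t \<noteq> 0 \<Longrightarrow> ec_scale t (ec_scale (1 / t) P) = P"
  by (cases P) (simp_all add: power_one_over)

lemma ec_scale_in_ec_points:
  "P \<in> ec_points a b \<Longrightarrow> ec_scale t P \<in> ec_points (t ^ 4 * a) (t ^ 6 * b)"
proof (cases P)
  case (Affine x y)
  assume "P \<in> ec_points a b"
  then have "y ^ 2 = x ^ 3 + a * x + b" using Affine by (simp add: ec_points_def)
  then have "(t ^ 3 * y) ^ 2 = (t ^ 2 * x) ^ 3 + t ^ 4 * a * (t ^ 2 * x) + t ^ 6 * b" by algebra
  then show ?thesis using Affine by (simp add: ec_points_def)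
qed (simp add: ec_points_def)

lemma ec_add_scale:
  assumes "t \<noteq> 0"
  shows "ec_add (t ^ 4 * a) (ec_scale t P) (ec_scale t Q) = ec_scale t (ec_add a P Q)"
proof (cases "P = Infinity \<or> Q = Infinity")
  case True
  then show ?thesis by (cases P; cases Q) auto
next
  case False
  then obtain x1 y1 x2 y2 where PQ: "P = Affine x1 y1" "Q = Affine x2 y2"
    by (metis ec_point.exhaust)
  show ?thesis
  proof (cases "x1 = x2 \<and> y1 = - y2")
    case True
    then show ?thesis using PQ by simp
  next
    case False
    define m where "m = (if x1 = x2 then (3 * x1 ^ 2 + a) / (2 * y1) else (y2 - y1) / (x2 - x1))"
    have eqx: "t ^ 2 * x1 = t ^ 2 * x2 \<longleftrightarrow> x1 = x2" and eqy: "t ^ 3 * y1 = - (t ^ 3 * y2) \<longleftrightarrow> y1 = - y2"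
      using assms by (simp_all flip: mult_minus_right)
    have 1: "3 * (t ^ 2 * x1) ^ 2 + t ^ 4 * a = t ^ 3 * (t * (3 * x1 ^ 2 + a))"
      "2 * (t ^ 3 * y1) = t ^ 3 * (2 * y1)" "t ^ 3 * y2 - t ^ 3 * y1 = t ^ 2 * (t * (y2 - y1))"
      "t ^ 2 * x2 - t ^ 2 * x1 = t ^ 2 * (x2 - x1)"
      by algebra+
    have m': "(if x1 = x2 then (3 * (t ^ 2 * x1) ^ 2 + t ^ 4 * a) / (2 * (t ^ 3 * y1))
        else (t ^ 3 * y2 - t ^ 3 * y1) / (t ^ 2 * x2 - t ^ 2 * x1)) = t * m"
      unfolding 1 m_def using assms by simp
    have "(t * m) ^ 2 - t ^ 2 * x1 - t ^ 2 * x2 = t ^ 2 * (m ^ 2 - x1 - x2)" by algebra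
    moreover have "t * m * (t ^ 2 * x1 - t ^ 2 * u) - t ^ 3 * y1 = t ^ 3 * (m * (x1 - u) - y1)" for u
      by algebra
    ultimately show ?thesis
      unfolding PQ ec_scale.simps ec_add.simps m' eqx eqy m_def[symmetric] Let_def
      using False by (simp only: if_False ec_scale.simps)
  qed
qed

lemma ec_mult_scale:
  assumes "t \<noteq> 0"
  shows "ec_mult (t ^ 4 * a) n (ec_scale t P) = ec_scale t (ec_mult a n P)"
  by (induction n) (simp_all add: ec_mult_def ec_add_scale[OF assms])

lemma supersingular_scale:
  fixes a b t :: "'a::alg_closed_field"
  assumes "supersingular a b" "t \<noteq> 0"
  shows "supersingular (t ^ 4 * a) (t ^ 6 * b)"
proof -
  have "4 * (t ^ 4 * a) ^ 3 + 27 * (t ^ 6 * b) ^ 2 = t ^ 12 * (4 * a ^ 3 + 27 * b ^ 2)" by algebra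
  then have "elliptic_curve (t ^ 4 * a) (t ^ 6 * b)"
    using assms by (simp add: supersingular_def elliptic_curve_def)
  moreover have "Q = Infinity" if Q: "Q \<in> ec_torsion (t ^ 4 * a) (t ^ 6 * b) CHAR('a)" for Q
  proof -
    define P where "P = ec_scale (1 / t) Q"
    have PQ: "ec_scale t P = Q" using assms(2) by (simp add: P_def ec_scale_scale_inverse)
    have "P \<in> ec_points ((1 / t) ^ 4 * (t ^ 4 * a)) ((1 / t) ^ 6 * (t ^ 6 * b))"
      unfolding P_def using Q by (intro ec_scale_in_ec_points) (simp add: ec_torsion_def)
    then have "P \<in> ec_points a b" using assms(2) by (simp add: power_one_over)
    moreover have "ec_scale t (ec_mult a CHAR('a) P) = Infinity"
      using Q assms(2) by (simp add: PQ ec_torsion_def flip: ec_mult_scale)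
    then have "ec_mult a CHAR('a) P = Infinity" by (cases "ec_mult a CHAR('a) P") auto
    ultimately have "P \<in> ec_torsion a b CHAR('a)" by (simp add: ec_torsion_def)
    then show "Q = Infinity" using assms(1) PQ by (auto simp: supersingular_def)
  qed
  moreover have "Infinity \<in> ec_torsion (t ^ 4 * a) (t ^ 6 * b) CHAR('a)"
  proof -
    have "ec_mult (t ^ 4 * a) n Infinity = Infinity" for n
      by (induction n) (simp_all add: ec_mult_def)
    then show ?thesis by (simp add: ec_torsion_def ec_points_def)
  qed
  ultimately show ?thesis unfolding supersingular_def by blast
qed

lemma j_invariant_eq_imp_scale:
  fixes a b a' b' :: "'a::alg_closed_field"
  assumes char: "(2 :: 'a) \<noteq> 0" "(3 :: 'a) \<noteq> 0"
    and ell: "elliptic_curve a b" "elliptic_curve a' b'"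
    and j: "j_invariant a b = j_invariant a' b'"
  obtains t where "t \<noteq> 0" "a' = t ^ 4 * a" "b' = t ^ 6 * b"
proof -
  have nz: "4 * a ^ 3 + 27 * b ^ 2 \<noteq> 0" "4 * a' ^ 3 + 27 * b' ^ 2 \<noteq> 0"
    using ell by (simp_all add: elliptic_curve_def)
  have "(2 :: 'a) ^ 8 * 3 ^ 6 \<noteq> 0"
    using char by (intro no_zero_divisors power_not_zero)
  have "1728 * (4 * a ^ 3) * (4 * a' ^ 3 + 27 * b' ^ 2) = 1728 * (4 * a' ^ 3) * (4 * a ^ 3 + 27 * b ^ 2)"
    using j nz by (simp add: j_invariant_def frac_eq_eq)
  then have "2 ^ 8 * 3 ^ 6 * (a ^ 3 * b' ^ 2 - a' ^ 3 * b ^ 2) = 0" by algebra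
  then have *: "a ^ 3 * b' ^ 2 = a' ^ 3 * b ^ 2" using \<open>(2 :: 'a) ^ 8 * 3 ^ 6 \<noteq> 0\<close>
    by (metis eq_iff_diff_eq_0 mult_eq_0_iff)
  consider "a = 0" | "b = 0" "a \<noteq> 0" | "a \<noteq> 0" "b \<noteq> 0" by blast
  then show ?thesis
  proof cases
    case 1
    then have b: "b \<noteq> 0" using nz by auto
    then have a': "a' = 0" using * 1 by auto
    then have b': "b' \<noteq> 0" using nz by auto
    obtain t where t: "t ^ 6 = b' / b" using nth_root_exists[of 6 "b' / b"] by auto
    then have "t \<noteq> 0" using b b' by auto
    then show ?thesis using t 1 a' b by (intro that[of t]) auto
  next
    case 2
    then have b': "b' = 0" using * by auto
    then have a': "a' \<noteq> 0" using nz by auto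
    obtain t where t: "t ^ 4 = a' / a" using nth_root_exists[of 4 "a' / a"] by auto
    then have "t \<noteq> 0" using 2 a' by auto
    then show ?thesis using t 2 b' by (intro that[of t]) auto
  next
    case 3
    have nz': "a' \<noteq> 0" "b' \<noteq> 0" using * 3 nz by auto
    \<comment> \<open>If \<open>t\<close> is the scaling factor sought, this quotient is
      \<open>t ^ 6 / t ^ 4\<close>.\<close>
    define w where "w = b' * a / (b * a')"
    have w: "w * (b * a') = b' * a" using 3 nz' by (simp add: w_def)
    have w2: "w ^ 2 * a = a'"
    proof -
      have "(b * a') ^ 2 * (w ^ 2 * a) = (b * a') ^ 2 * a'" using w * by algebra
      then show ?thesis using 3 nz' by simp
    qed
    have w3: "w ^ 3 * b = b'"
    proof -
      have "a' * (w ^ 3 * b) = a' * b'" using w w2 by algebra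
      then show ?thesis using nz' by simp
    qed
    obtain t where t: "t ^ 2 = w" using nth_root_exists[of 2 w] by auto
    have "t ^ 4 = w ^ 2" "t ^ 6 = w ^ 3" unfolding t[symmetric] by (simp_all flip: power_mult)
    moreover have "t \<noteq> 0" using t w nz' 3 by auto
    ultimately show ?thesis using w2 w3 by (intro that[of t]) auto
  qed
qed

text \<open>\<open>supersingular_j\<close> only provides some model; models with equal
  \<open>j\<close> differ by a scaling, so a prescribed one may be used.\<close>

lemma supersingular_j_iff:
  fixes a b :: "'a::alg_closed_field"
  assumes "(2 :: 'a) \<noteq> 0" "(3 :: 'a) \<noteq> 0" "elliptic_curve a b"
  shows "supersingular_j (j_invariant a b) \<longleftrightarrow> supersingular a b"
proof
  assume "supersingular_j (j_invariant a b)"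
  then obtain a0 b0 where 0: "supersingular a0 b0" "j_invariant a0 b0 = j_invariant a b"
    by (auto simp: supersingular_j_def)
  then have "elliptic_curve a0 b0" by (simp add: supersingular_def)
  then obtain t where "t \<noteq> 0" "a = t ^ 4 * a0" "b = t ^ 6 * b0"
    using j_invariant_eq_imp_scale[OF assms(1,2) _ assms(3)] 0(2) by metis
  then show "supersingular a b" using supersingular_scale 0(1) by blast
qed (auto simp: supersingular_j_def)

section \<open>The isogeny whose kernel is generated by a given 2-torsion point\<close>

locale two_isogeny = short_weierstrass +
  fixes e :: 'a
  assumes root: "Affine e 0 \<in> ec_points a b"
begin

definition t where "t = 3 * e ^ 2 + a"

text \<open>Velu's formulas for the isogeny with kernel generated by \<open>(e, 0)\<close>.\<close>

definition a' where "a' = a - 5 * t"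
definition b' where "b' = b - 7 * t * e"

fun isog :: "'a ec_point \<Rightarrow> 'a ec_point" where
  "isog Infinity = Infinity"
| "isog (Affine x y) = (if x = e then Infinity else Affine (x + t / (x - e)) (y * (1 - t / (x - e) ^ 2)))"

lemma a_eq: "a = t - 3 * e ^ 2" and b_eq: "b = 2 * e ^ 3 - t * e"
proof -
  show "a = t - 3 * e ^ 2" by (simp add: t_def)
  then show "b = 2 * e ^ 3 - t * e" 
  proof -
    assume a: "a = t - 3 * e ^ 2"
    have "e ^ 3 + a * e + b = 0" using root by simp
    then show ?thesis using a by algebra
  qed
qed

lemma cubic_at_e: "x ^ 3 + a * x + b = (x - e) ^ 3 + 3 * e * (x - e) ^ 2 + t * (x - e)"
  using a_eq b_eq by algebra

lemma t_neq_0: "t \<noteq> 0"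
  using smooth[of e] root by (simp add: t_def)

sublocale image: short_weierstrass a' b'
proof
  have "4 * a ^ 3 + 27 * b ^ 2 = (4 * t - 9 * e ^ 2) * t ^ 2"
    using a_eq b_eq by algebra
  then have "4 * t - 9 * e ^ 2 \<noteq> 0"
    using elliptic by (auto simp: elliptic_curve_def)
  then have "- 16 * (4 * t - 9 * e ^ 2) ^ 2 * t \<noteq> 0"
    using t_neq_0 two_neq_0 power_not_zero[OF two_neq_0, of 4] by simp
  moreover have "4 * a' ^ 3 + 27 * b' ^ 2 = - 16 * (4 * t - 9 * e ^ 2) ^ 2 * t"
    using a_eq b_eq unfolding a'_def b'_def by algebra
  ultimately show "elliptic_curve a' b'" by (simp add: elliptic_curve_def)
qed (fact two_neq_0 three_neq_0)+

lemma isog_eq_Infinity_iff: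
  assumes "P \<in> E"
  shows "isog P = Infinity \<longleftrightarrow> P = Infinity \<or> P = Affine e 0"
  using assms root by (cases P) auto

lemma isog_in_E [simp]:
  assumes "P \<in> E"
  shows "isog P \<in> ec_points a' b'"
proof (cases P)
  case (Affine x y)
  show ?thesis
  proof (cases "x = e")
    case False
    define i where "i = 1 / (x - e)"
    have i: "i * (x - e) = 1" using False by (simp add: i_def)
    have y: "y ^ 2 = (x - e) ^ 3 + 3 * e * (x - e) ^ 2 + t * (x - e)"
      using assms Affine cubic_at_e by simp
    have "(y * (1 - t * i ^ 2)) ^ 2 = (x + t * i) ^ 3 + a' * (x + t * i) + b'"
      using i a_eq b_eq unfolding power_mult_distrib y a'_def b'_def by algebra
    then show ?thesis using Affine False by (simp add: i_def power_one_over)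
  qed (use Affine in simp)
qed simp

text \<open>Points of the line with slope \<open>m\<close> and value \<open>\<mu>\<close> at
  \<open>e\<close> are mapped into a line, of slope \<open>m - t / \<mu>\<close>; hence collinear
  triples go to collinear triples.\<close>

lemma isog_line:
  assumes "y ^ 2 = x ^ 3 + a * x + b" "y = \<mu> + m * (x - e)" "x \<noteq> e" "\<mu> \<noteq> 0"
  shows "\<mu> * (y * (1 - t / (x - e) ^ 2)) = (m * \<mu> - t) * (x + t / (x - e) + 2 * e) +
    m ^ 2 * t + \<mu> ^ 2 - 3 * e * m * \<mu>"
proof -
  define d i where "d = x - e" and "i = 1 / (x - e)"
  have i: "i * d = 1" using assms(3) by (simp add: i_def d_def)
  have y: "y ^ 2 = d ^ 3 + 3 * e * d ^ 2 + t * d" using assms(1) cubic_at_e by (simp add: d_def)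
  have yd: "y = \<mu> + m * d" using assms(2) by (simp add: d_def)
  have yi: "y ^ 2 * i ^ 2 = d + 3 * e + t * i" using i unfolding y by algebra
  \<comment> \<open>The second factor is, up to sign, the first one composed with translation by the
    kernel point, which replaces \<open>d\<close> by \<open>t * i\<close> and \<open>y\<close> by
    \<open>- t * y * i ^ 2\<close>. The product is therefore invariant under the kernel and gives a
    function on the image curve.\<close>
  have "(y - m * d - \<mu>) * (t * y * i ^ 2 + m * t * i + \<mu>) = 0" using yd by simp
  then have "t * (y ^ 2 * i ^ 2) - m * t * (y * i) * (d * i) + y * m * t * i + \<mu> * y
      - \<mu> * t * y * i ^ 2 - m ^ 2 * t * (d * i) - m * \<mu> * d - \<mu> * m * t * i - \<mu> ^ 2 = 0"
    by algebra
  then have "\<mu> * (y * (1 - t * i ^ 2)) = (m * \<mu> - t) * (d + t * i + 3 * e) +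
      m ^ 2 * t + \<mu> ^ 2 - 3 * e * m * \<mu>"
    using i unfolding yi by algebra
  then show ?thesis unfolding i_def d_def by (simp add: power_one_over algebra_simps)
qed

text \<open>The two points and the negative of their sum lie on a line, and \<open>isog_line\<close>
  applies to all three. The condition on \<open>e + t / (x1 - e)\<close>, the first coordinate of
  the translate by the kernel point, keeps the images apart, so that the image sum is formed by a
  chord.\<close>

lemma isog_add_generic:
  assumes E: "Affine x1 y1 \<in> E" "Affine x2 y2 \<in> E"
    and ne: "x1 \<noteq> e" "x2 \<noteq> e" "x1 \<noteq> x2" "x2 \<noteq> e + t / (x1 - e)"
    and S: "Affine x1 y1 \<oplus> Affine x2 y2 = Affine x3 y3" "x3 \<noteq> e"
  shows "isog (Affine x1 y1 \<oplus> Affine x2 y2) =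
    image.add (isog (Affine x1 y1)) (isog (Affine x2 y2))"
proof -
  obtain m where m: "y2 = y1 + m * (x2 - x1)" "m * (y1 + y2) = x1 ^ 2 + x1 * x2 + x2 ^ 2 + a"
    using slope_exists[OF E] ne(3) by metis
  have x3: "x3 = m ^ 2 - x1 - x2" and y3: "y3 = - (y1 + m * (x3 - x1))"
    using S(1) ec_add_Affine[OF m] ne(3) by auto
  have E3: "Affine x3 y3 \<in> E" using ec_add_closed[OF E] S(1) by simp
  then have E3': "Affine x3 (- y3) \<in> E" by simp
  define \<mu> where "\<mu> = y1 + m * (e - x1)"
  define d1 d2 d3 where "d1 = x1 - e" and "d2 = x2 - e" and "d3 = x3 - e"
  have d: "d1 \<noteq> 0" "d2 \<noteq> 0" "d3 \<noteq> 0" using ne S(2) by (simp_all add: d1_def d2_def d3_def)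
  \<comment> \<open>The \<open>d\<close>s are the zeros of the curve equation restricted to the
    line, a cubic in \<open>x - e\<close>; this and the next two facts are its Vieta
    relations.\<close>
  have e3: "d1 * d2 * d3 = \<mu> ^ 2"
    using m E(1) x3 a_eq b_eq unfolding d1_def d2_def d3_def \<mu>_def Affine_in_E by algebra
  then have \<mu>: "\<mu> \<noteq> 0" using d by auto
  have e1: "d1 + d2 + d3 = m ^ 2 - 3 * e" using x3 by (simp add: d1_def d2_def d3_def)
  have e2: "d1 * d2 + d1 * d3 + d2 * d3 = t - 2 * m * \<mu>"
    using m E(1) x3 a_eq b_eq unfolding d1_def d2_def d3_def \<mu>_def Affine_in_E by algebra
  define X where "X x = x + t / (x - e)" for x
  define Y where "Y x y = y * (1 - t / (x - e) ^ 2)" for x y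
  define M where "M = m - t / \<mu>"
  have M: "M * \<mu> = m * \<mu> - t" using \<mu> by (simp add: M_def field_simps)
  have line: "\<mu> * Y x y = M * \<mu> * (X x + 2 * e) + m ^ 2 * t + \<mu> ^ 2 - 3 * e * m * \<mu>"
    if "Affine x y \<in> E" "y = \<mu> + m * (x - e)" "x \<noteq> e" for x y
    using isog_line[OF _ that(2,3) \<mu>] that(1) unfolding M X_def Y_def by simp
  have "y1 = \<mu> + m * (x1 - e)" "y2 = \<mu> + m * (x2 - e)" "- y3 = \<mu> + m * (x3 - e)"
    using m(1) y3 by (auto simp: \<mu>_def algebra_simps)
  note lines = line[OF E(1) this(1) ne(1)] line[OF E(2) this(2) ne(2)] line[OF E3' this(3) S(2)]
  have "\<mu> * Y x2 y2 = \<mu> * (Y x1 y1 + M * (X x2 - X x1))"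
    using lines(1,2) by algebra
  then have M1: "Y x2 y2 = Y x1 y1 + M * (X x2 - X x1)" using \<mu> by simp
  have "\<mu> * Y x3 (- y3) = \<mu> * (Y x1 y1 + M * (X x3 - X x1))"
    using lines(1,3) by algebra
  then have M3: "Y x3 (- y3) = Y x1 y1 + M * (X x3 - X x1)" using \<mu> by simp
  have XE: "Affine (X x1) (Y x1 y1) \<in> ec_points a' b'" "Affine (X x2) (Y x2 y2) \<in> ec_points a' b'"
    using isog_in_E[OF E(1)] isog_in_E[OF E(2)] ne by (simp_all add: X_def Y_def)
  have "X x2 - X x1 = (x2 - x1) * (1 - t / (d1 * d2))"
  proof -
    have "1 / d1 * d1 = 1" "1 / d2 * d2 = 1" using d by simp_all
    then have "x2 + t * (1 / d2) - (x1 + t * (1 / d1)) = (x2 - x1) * (1 - t * (1 / d1) * (1 / d2))"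
      using d1_def d2_def by algebra
    then show ?thesis by (simp add: X_def flip: d1_def d2_def)
  qed
  moreover have "t \<noteq> d1 * d2" using ne(1,4) by (auto simp: d1_def d2_def field_simps)
  ultimately have X12: "X x1 \<noteq> X x2" using ne(3) d by auto
  obtain M' where M': "Y x2 y2 = Y x1 y1 + M' * (X x2 - X x1)"
    "M' * (Y x1 y1 + Y x2 y2) = X x1 ^ 2 + X x1 * X x2 + X x2 ^ 2 + a'"
    using image.slope_exists[OF XE] X12 by metis
  have "M' = M" using M1 M'(1) X12 by auto
  have "M ^ 2 - X x1 - X x2 = X x3"
  proof -
    have "t / d1 = t * (d2 * d3) / \<mu> ^ 2" "t / d2 = t * (d1 * d3) / \<mu> ^ 2" "t / d3 = t * (d1 * d2) / \<mu> ^ 2"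
      using d \<mu> unfolding e3[symmetric] by simp_all
    then have "X x1 + X x2 + X x3 = x1 + x2 + x3 + (t * (d2 * d3) + t * (d1 * d3) + t * (d1 * d2)) / \<mu> ^ 2"
      by (simp add: X_def add_divide_distrib flip: d1_def d2_def d3_def)
    also have "t * (d2 * d3) + t * (d1 * d3) + t * (d1 * d2) = t * (t - 2 * m * \<mu>)"
      using e2 by algebra
    also have "x1 + x2 + x3 + t * (t - 2 * m * \<mu>) / \<mu> ^ 2 = M ^ 2"
      using \<mu> x3 by (simp add: M_def field_simps power2_eq_square)
    finally show ?thesis by (simp add: algebra_simps)
  qed
  then have "image.add (Affine (X x1) (Y x1 y1)) (Affine (X x2) (Y x2 y2)) =
      Affine (X x3) (- (Y x1 y1 + M * (X x3 - X x1)))"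
    using image.ec_add_Affine[OF M'] X12 \<open>M' = M\<close> by simp
  also have "- (Y x1 y1 + M * (X x3 - X x1)) = Y x3 y3"
    unfolding M3[symmetric] by (simp add: Y_def)
  finally show ?thesis using S ne by (simp add: X_def Y_def del: ec_add.simps)
qed

text \<open>Translation by the kernel point exchanges the two summands \<open>x - e\<close> and
  \<open>t / (x - e)\<close> in the first coordinate of \<open>isog\<close>, up to the constant
  \<open>e\<close>.\<close>

lemma isog_add_kernel:
  assumes "Affine x y \<in> E" "x \<noteq> e"
  shows "isog (Affine e 0 \<oplus> Affine x y) = isog (Affine x y)"
proof -
  define d i where "d = x - e" and "i = 1 / (x - e)"
  have i: "i * d = 1" "d \<noteq> 0" using assms(2) by (simp_all add: i_def d_def)
  have y: "y ^ 2 = d ^ 3 + 3 * e * d ^ 2 + t * d" using assms(1) cubic_at_e by (simp add: d_def)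
  have x: "x = e + d" by (simp add: d_def)
  define m where "m = y * i"
  have m: "y = 0 + m * (x - e)" "m * (0 + y) = e ^ 2 + e * x + x ^ 2 + a"
  proof -
    show "y = 0 + m * (x - e)" using i x unfolding m_def by algebra
    have "m * y = d ^ 2 + 3 * e * d + t" using i y unfolding m_def by algebra
    then show "m * (0 + y) = e ^ 2 + e * x + x ^ 2 + a" using a_eq unfolding x by algebra
  qed
  have m2: "m ^ 2 - e - x = e + t * i"
    using i(1) y unfolding m_def x power_mult_distrib by algebra
  have "Affine e 0 \<oplus> Affine x y = Affine (e + t * i) (- (m * (t * i)))"
    using ec_add_Affine[OF m] assms(2) unfolding m2 by simp
  moreover have "e + t * i \<noteq> e" using t_neq_0 i by auto
  moreover have td: "t / (t * i) = d"
  proof -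
    have "t = d * (t * i)" using i(1) by algebra
    moreover have "t * i \<noteq> 0" using t_neq_0 i by auto
    ultimately show ?thesis by (metis nonzero_divide_eq_eq)
  qed
  moreover have "t / (t * i) ^ 2 = d ^ 2 / t"
    unfolding td[symmetric] using t_neq_0 by (simp add: power2_eq_square)
  moreover have "- (m * (t * i)) * (1 - d ^ 2 / t) = y * (1 - t * i ^ 2)"
  proof -
    have "d ^ 2 / t * t = d ^ 2" using t_neq_0 by simp
    then show ?thesis using i(1) unfolding m_def by algebra
  qed
  ultimately show ?thesis using assms(2) by (simp add: i_def x power_one_over del: ec_add.simps)
qed

lemma almost_all_isog_add:
  assumes "P \<in> E"
  shows "almost_all (\<lambda>S. isog (P \<oplus> S) = image.add (isog P) (isog S))"
proof -
  consider "P = Infinity" | "P = Affine e 0" | x y where "P = Affine x y" "x \<noteq> e"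
  proof (cases P)
    case (Affine x y)
    then show ?thesis using assms root that(2) that(3)[of x y] by (cases "x = e") simp_all
  qed (rule that(1))
  then show ?thesis
  proof cases
    case 1
    then show ?thesis by (simp add: almost_all_def)
  next
    case 2
    show ?thesis
      by (rule almost_all_mono[OF almost_all_x_neq[of e]])
        (use 2 isog_add_kernel in \<open>auto simp del: ec_add.simps(3)\<close>)
  next
    case 3
    have "almost_all (\<lambda>S. ((\<exists>x' y'. S = Affine x' y' \<and> x' \<noteq> e) \<and> (\<exists>x' y'. S = Affine x' y' \<and> x' \<noteq> x)) \<and>
        (\<exists>x' y'. S = Affine x' y' \<and> x' \<noteq> e + t / (x - e)) \<and> (\<exists>x' y'. P \<oplus> S = Affine x' y' \<and> x' \<noteq> e))"
      using almost_all_translate[OF almost_all_x_neq assms]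
      by (intro almost_all_conj almost_all_x_neq)
    then show ?thesis
    proof (rule almost_all_mono)
      fix S assume "S \<in> E" and "((\<exists>x' y'. S = Affine x' y' \<and> x' \<noteq> e) \<and> (\<exists>x' y'. S = Affine x' y' \<and> x' \<noteq> x)) \<and>
        (\<exists>x' y'. S = Affine x' y' \<and> x' \<noteq> e + t / (x - e)) \<and> (\<exists>x' y'. P \<oplus> S = Affine x' y' \<and> x' \<noteq> e)"
      then obtain x2 y2 x3 y3 where *: "S = Affine x2 y2" "x2 \<noteq> e" "x \<noteq> x2" "x2 \<noteq> e + t / (x - e)"
        "P \<oplus> S = Affine x3 y3" "x3 \<noteq> e" by auto
      then show "isog (P \<oplus> S) = image.add (isog P) (isog S)"
        using isog_add_generic[of x y x2 y2 x3 y3] 3 assms \<open>S \<in> E\<close> by blast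
    qed
  qed
qed

text \<open>The generic case extends as for associativity: after adding a generic \<open>S\<close>,
  only generic instances are needed, and \<open>isog S\<close> is cancelled on the image
  curve.\<close>

theorem isog_add:
  assumes "P \<in> E" "Q \<in> E"
  shows "isog (P \<oplus> Q) = image.add (isog P) (isog Q)"
proof -
  let ?h = "\<lambda>P S. isog (P \<oplus> S) = image.add (isog P) (isog S)"
  have "almost_all (\<lambda>S. ?h (P \<oplus> Q) S \<and> ?h P (Q \<oplus> S) \<and> ?h Q S)"
    using assms almost_all_translate[OF almost_all_isog_add[OF assms(1)] assms(2)]
    by (intro almost_all_conj almost_all_isog_add) auto
  then obtain S where SE: "S \<in> E" "?h (P \<oplus> Q) S \<and> ?h P (Q \<oplus> S) \<and> ?h Q S"
    by (rule almost_all_ex)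
  note S = conjunct1[OF this(2)] conjunct1[OF conjunct2[OF this(2)]] conjunct2[OF conjunct2[OF this(2)]]
  have "image.add (isog (P \<oplus> Q)) (isog S) = isog (P \<oplus> Q \<oplus> S)" using S(1) by (simp only:)
  also have "\<dots> = isog (P \<oplus> (Q \<oplus> S))" using assms SE by (simp only: ec_add_assoc)
  also have "\<dots> = image.add (isog P) (image.add (isog Q) (isog S))" using S(2,3) by (simp only:)
  also have "\<dots> = image.add (image.add (isog P) (isog Q)) (isog S)"
    using assms SE by (simp only: image.ec_add_assoc isog_in_E)
  finally have *: "image.add (isog (P \<oplus> Q)) (isog S) =
      image.add (image.add (isog P) (isog Q)) (isog S)" .
  show ?thesis
    by (rule image.ec_add_right_cancel[OF _ _ _ *]) (use assms SE in simp_all)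
qed

lemma isog_mult:
  assumes "P \<in> E"
  shows "isog (n \<odot> P) = image.mult n (isog P)"
  by (induction n) (use assms in \<open>simp_all add: ec_mult_Suc image.ec_mult_Suc isog_add\<close>)

text \<open>A \<open>p\<close>-torsion point goes to a \<open>p\<close>-torsion point, hence to
  \<open>Infinity\<close>, so it lies in the kernel; there multiplication by an odd number is the
  identity.\<close>

lemma supersingular_if_image:
  assumes "supersingular a' b'" "odd CHAR('a)"
  shows "supersingular a b"
proof -
  let ?p = "CHAR('a)"
  have "P = Infinity" if P: "P \<in> ec_torsion a b ?p" for P
  proof -
    have PE: "P \<in> E" "?p \<odot> P = Infinity" using P by (simp_all add: ec_torsion_def)
    then have "isog P \<in> ec_torsion a' b' ?p"
      using isog_mult[of P ?p] by (simp add: ec_torsion_def)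
    then have "isog P = Infinity" using assms(1) by (simp add: supersingular_def)
    then show "P = Infinity"
      using isog_eq_Infinity_iff PE two_torsion_odd_mult[OF root assms(2)] by auto
  qed
  moreover have "Infinity \<in> ec_torsion a b ?p" by (simp add: ec_torsion_def)
  ultimately show ?thesis using elliptic unfolding supersingular_def by blast
qed

end

subsection \<open>Torsion points of order 3 and 4\<close>

lemma depressed_quartic_roots:
  fixes P Q R :: "'a::alg_closed_field"
  obtains x1 x2 x3 x4 where "x1 + x2 + x3 + x4 = 0"
    "P = x1 * x2 + x1 * x3 + x1 * x4 + x2 * x3 + x2 * x4 + x3 * x4"
    "Q = - (x1 * x2 * x3 + x1 * x2 * x4 + x1 * x3 * x4 + x2 * x3 * x4)"
    "R = x1 * x2 * x3 * x4"
proof -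
  have root: "\<exists>x. poly f x = 0" if "degree f > 0" for f :: "'a poly"
    using alg_closed_imp_poly_has_root that by blast
  obtain x1 where "poly [:R, Q, P, 0, 1:] x1 = 0" using root[of "[:R, Q, P, 0, 1:]"] by auto
  then have 1: "x1 ^ 4 + P * x1 ^ 2 + Q * x1 + R = 0"
    by (simp add: algebra_simps power4_eq_xxxx power2_eq_square)
  obtain x2 where "poly [:x1 ^ 3 + P * x1 + Q, x1 ^ 2 + P, x1, 1:] x2 = 0"
    using root[of "[:x1 ^ 3 + P * x1 + Q, x1 ^ 2 + P, x1, 1:]"] by auto
  then have 2: "x2 ^ 3 + x1 * x2 ^ 2 + (x1 ^ 2 + P) * x2 + (x1 ^ 3 + P * x1 + Q) = 0"
    by (simp add: algebra_simps power3_eq_cube power2_eq_square)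
  obtain x3 where "poly [:x1 ^ 2 + x1 * x2 + x2 ^ 2 + P, x1 + x2, 1:] x3 = 0"
    using root[of "[:x1 ^ 2 + x1 * x2 + x2 ^ 2 + P, x1 + x2, 1:]"] by auto
  then have 3: "x3 ^ 2 + (x1 + x2) * x3 + x1 ^ 2 + x1 * x2 + x2 ^ 2 + P = 0"
    by (simp add: algebra_simps power2_eq_square)
  define x4 where "x4 = - (x1 + x2 + x3)"
  have P: "P = - (x3 ^ 2 + (x1 + x2) * x3 + x1 ^ 2 + x1 * x2 + x2 ^ 2)" using 3 by algebra
  have Q: "Q = - (x2 ^ 3 + x1 * x2 ^ 2 + (x1 ^ 2 + P) * x2 + x1 ^ 3 + P * x1)" using 2 by algebra
  have R: "R = - (x1 ^ 4 + P * x1 ^ 2 + Q * x1)" using 1 by algebra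
  show ?thesis
  proof (rule that)
    show "x1 + x2 + x3 + x4 = 0" by (simp add: x4_def)
    show "P = x1 * x2 + x1 * x3 + x1 * x4 + x2 * x3 + x2 * x4 + x3 * x4"
      unfolding P x4_def by algebra
    show "Q = - (x1 * x2 * x3 + x1 * x2 * x4 + x1 * x3 * x4 + x2 * x3 * x4)"
      unfolding Q P x4_def by algebra
    show "R = x1 * x2 * x3 * x4"
      unfolding R Q P x4_def by algebra
  qed
qed

context short_weierstrass
begin

lemma mult_of_torsion:
  assumes "P \<in> E" "k \<odot> P = Infinity" "n mod k = 1 \<or> Suc (n mod k) = k"
  shows "n \<odot> P = P \<or> n \<odot> P = ec_neg P"
proof -
  have *: "m \<odot> P = (m mod k) \<odot> P" for m
    using ec_mult_add[OF assms(1), of "(m div k) * k" "m mod k"] assms(1,2)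
    by (simp add: ec_mult_mult)
  from assms(3) show ?thesis
  proof
    assume "n mod k = 1"
    then show ?thesis using *[of n] by simp
  next
    assume "Suc (n mod k) = k"
    then have "P \<oplus> (n mod k) \<odot> P = Infinity" using assms(2) by (metis ec_mult_Suc)
    then have "P \<oplus> n \<odot> P = Infinity" using *[of n] by simp
    then show ?thesis using ec_neg_unique assms(1) ec_mult_closed by blast
  qed
qed

text \<open>The quartic is the 3-division polynomial: its vanishing says that the double of the
  point has the same first coordinate as the point.\<close>

lemma three_torsion:
  assumes "Affine x y \<in> E" "3 * x ^ 4 + 6 * a * x ^ 2 + 12 * b * x - a ^ 2 = 0"
  shows "3 \<odot> Affine x y = Infinity"
proof -
  have y: "y ^ 2 = x ^ 3 + a * x + b" using assms(1) by simp
  have eq: "12 * x * y ^ 2 = (3 * x ^ 2 + a) ^ 2" using assms(2) unfolding y by algebra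
  have "y \<noteq> 0"
  proof
    assume "y = 0"
    then have "3 * x ^ 2 + a = 0" using eq by simp
    then show False using smooth[of x] y \<open>y = 0\<close> by simp
  qed
  then have ne: "\<not> (x = x \<and> y = - y)" using eq_uminus_self_iff by blast
  obtain m where m: "y = y + m * (x - x)" "m * (y + y) = x ^ 2 + x * x + x ^ 2 + a"
    using slope_exists[OF assms(1) assms(1) ne] .
  have "(2 * y) ^ 2 * (m ^ 2 - 3 * x) = 0" using m(2) eq by algebra
  moreover have "2 * y \<noteq> 0" using \<open>y \<noteq> 0\<close> two_neq_0 by simp
  ultimately have "m ^ 2 - 3 * x = 0" by (metis mult_eq_0_iff power_not_zero)
  then have "m ^ 2 - x - x = x" by simp
  then have "Affine x y \<oplus> Affine x y = ec_neg (Affine x y)"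
    using ec_add_Affine[OF m ne] by simp
  then have "Affine x y \<oplus> (Affine x y \<oplus> Affine x y) = Infinity" by (simp only: ec_add_neg_right)
  then show ?thesis by (simp add: numeral_3_eq_3 ec_mult_Suc del: ec_add.simps(3))
qed

end

section \<open>The subfield with \<open>p ^ 2\<close> elements\<close>

locale char_not_2_3 =
  fixes p :: nat and ty :: "'a::alg_closed_field itself"
  assumes CHAR_eq: "CHAR('a) = p" and prime_p: "prime p" and not_dvd_6: "\<not> p dvd 6"
begin

abbreviation K :: "'a set" where "K \<equiv> Fq (p ^ 2)"

lemma p_not_dvd: "\<not> p dvd 2" "\<not> p dvd 3"
  using not_dvd_6 dvd_trans[of p 2 6] dvd_trans[of p 3 6] by auto

lemma odd_p: "odd p"
  using p_not_dvd(1) prime_p primes_dvd_imp_eq two_is_prime_nat by blast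

lemma not_3_dvd_p: "\<not> 3 dvd p"
  using p_not_dvd(2) prime_p primes_dvd_imp_eq[of 3 p] by auto

lemma two_neq_0: "(2::'a) \<noteq> 0"
  using of_nat_eq_0_iff_char_dvd[where 'a = 'a, of 2] p_not_dvd(1) CHAR_eq by simp

lemma three_neq_0: "(3::'a) \<noteq> 0"
  using of_nat_eq_0_iff_char_dvd[where 'a = 'a, of 3] p_not_dvd(2) CHAR_eq by simp

lemma frobenius_add: "(x + y :: 'a) ^ p ^ 2 = x ^ p ^ 2 + y ^ p ^ 2"
  using freshmans_dream'[where 'a = 'a and m = "p ^ 2" and n = 2] CHAR_eq prime_p by simp

lemma frobenius_minus: "(- x :: 'a) ^ p ^ 2 = - (x ^ p ^ 2)"
  using odd_p by simp

lemma frobenius_diff: "(x - y :: 'a) ^ p ^ 2 = x ^ p ^ 2 - y ^ p ^ 2"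
  unfolding diff_conv_add_uminus frobenius_add frobenius_minus ..

lemma frobenius_power: "((x :: 'a) ^ n) ^ p ^ 2 = (x ^ p ^ 2) ^ n"
  by (simp add: mult.commute flip: power_mult)

lemma Fq_iff: "x \<in> Fq n \<longleftrightarrow> x ^ n = x"
  by (simp add: Fq_def)

lemma K_0 [simp]: "0 \<in> K" and K_1 [simp]: "1 \<in> K"
  using prime_gt_0_nat[OF prime_p] by (simp_all add: Fq_iff)

lemma K_add: "x \<in> K \<Longrightarrow> y \<in> K \<Longrightarrow> x + y \<in> K"
  by (simp add: Fq_iff frobenius_add)

lemma K_diff: "x \<in> K \<Longrightarrow> y \<in> K \<Longrightarrow> x - y \<in> K"
  by (simp add: Fq_iff frobenius_diff)

lemma K_minus: "x \<in> K \<Longrightarrow> - x \<in> K"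
  using K_diff[OF K_0] by fastforce

lemma K_mult: "x \<in> K \<Longrightarrow> y \<in> K \<Longrightarrow> x * y \<in> K"
  by (simp add: Fq_iff power_mult_distrib)

lemma K_divide: "x \<in> K \<Longrightarrow> y \<in> K \<Longrightarrow> x / y \<in> K"
  by (simp add: Fq_iff power_divide)

lemma K_power: "x \<in> K \<Longrightarrow> x ^ n \<in> K"
  by (simp add: Fq_iff frobenius_power)

lemma K_of_nat: "of_nat n \<in> K"
  by (induction n) (simp_all add: K_add)

lemma K_numeral [simp]: "numeral n \<in> K"
  using K_of_nat[of "numeral n"] by simp

lemmas K_intros = K_add K_diff K_minus K_mult K_divide K_power

lemma K_mult_cancel: "x * y \<in> K \<Longrightarrow> x \<in> K \<Longrightarrow> x \<noteq> 0 \<Longrightarrow> y \<in> K"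
  using K_divide[of "x * y" x] by simp

text \<open>The square of a number prime to 6 is 1 modulo 24.\<close>

lemma root_of_unity_24:
  assumes "(x :: 'a) ^ 24 = 1"
  shows "x \<in> K"
proof -
  have "p mod 24 < 24" "odd (p mod 24)" "\<not> 3 dvd p mod 24"
    using odd_p not_3_dvd_p by presburger+
  then have "p mod 24 \<in> {1, 5, 7, 11, 13, 17, 19, 23}" by simp presburger
  then have "(p mod 24) ^ 2 mod 24 = 1" by auto
  then have "p ^ 2 mod 24 = 1" by (simp add: power_mod)
  then have "x ^ p ^ 2 = x ^ (24 * (p ^ 2 div 24) + 1)" by (metis mult_div_mod_eq)
  then show ?thesis using assms by (simp add: Fq_iff power_add power_mult)
qed

lemma sqrt_minus_1_in_K: "i ^ 2 = - 1 \<Longrightarrow> i \<in> K"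
  using root_of_unity_24[of i] power_mult[of i 2 12] by simp

lemma eighth_root_in_K: "z ^ 4 = - 1 \<Longrightarrow> z \<in> K"
  using root_of_unity_24[of z] power_mult[of z 4 6] by simp

lemma sqrt_2_in_K:
  assumes "(s :: 'a) ^ 2 = 2"
  shows "s \<in> K"
proof -
  obtain z :: 'a where z: "z ^ 4 = - 1" using nth_root_exists[of 4 "- 1"] by auto
  \<comment> \<open>With \<open>z ^ 4 = - 1\<close> the square is \<open>z ^ 2 + 2 + z ^ 6\<close>,
    which is 2.\<close>
  have "(z - z ^ 3) ^ 2 = s ^ 2" using z assms by algebra
  then have "s = z - z ^ 3 \<or> s = - (z - z ^ 3)" by (metis power2_eq_iff)
  then show ?thesis using eighth_root_in_K[OF z] by (auto intro!: K_intros simp del: minus_diff_eq)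
qed

end

section \<open>The elliptic curve of a Weber point and its small torsion\<close>

context char_not_2_3
begin

text \<open>The curve with 2-torsion points \<open>(e\<^sub>i, 0)\<close>, where \<open>e\<^sub>1 + e\<^sub>2 + e\<^sub>3 = 0\<close>, \<open>e\<^sub>1 - e\<^sub>2 = A\<^sub>0\<close>,
  \<open>e\<^sub>2 - e\<^sub>3 = A\<^sub>1\<close> and \<open>e\<^sub>3 - e\<^sub>1 = A\<^sub>2\<close>.\<close>

definition weber_a :: "'a \<Rightarrow> 'a \<Rightarrow> 'a \<Rightarrow> 'a" where
  "weber_a A0 A1 A2 = (A0 * A1 + A1 * A2 + A2 * A0) / 3"

definition weber_b :: "'a \<Rightarrow> 'a \<Rightarrow> 'a \<Rightarrow> 'a" where
  "weber_b A0 A1 A2 = - ((A0 - A2) / 3 * ((A1 - A0) / 3) * ((A2 - A1) / 3))"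

text \<open>The relations between the eighth powers of the affine coordinates of a Weber point; 16
  is the eighth power of the square root of 2.\<close>

definition weber_roots :: "'a \<Rightarrow> 'a \<Rightarrow> 'a \<Rightarrow> bool" where
  "weber_roots A0 A1 A2 \<longleftrightarrow> A0 + A1 + A2 = 0 \<and> A0 * A1 * A2 = 16"

lemma three_div_3: "3 * ((x::'a) / 3) = x"
  using three_neq_0 by simp

lemma three_cancel: "3 * x = 3 * y \<Longrightarrow> x = (y::'a)"
  using three_neq_0 by (metis mult_left_cancel)

lemma sixteen_neq_0: "(16::'a) \<noteq> 0"
  using power_not_zero[OF two_neq_0, of 4] by simp

lemma weber_discriminant:
  assumes "weber_roots A0 A1 A2"
  shows "4 * weber_a A0 A1 A2 ^ 3 + 27 * weber_b A0 A1 A2 ^ 2 = - 256"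
proof -
  define u v w where "u = (A0 - A2) / 3" and "v = (A1 - A0) / 3" and "w = (A2 - A1) / 3"
  have uvw: "3 * u = A0 - A2" "3 * v = A1 - A0" "3 * w = A2 - A1"
    unfolding u_def v_def w_def by (rule three_div_3)+
  have A: "A0 = u - v" "A1 = v - w" "A2 = w - u"
  proof -
    have sum: "A0 + A1 + A2 = 0" using assms by (simp add: weber_roots_def)
    have "3 * (u - v) = 3 * A0" "3 * (v - w) = 3 * A1" "3 * (w - u) = 3 * A2" using uvw sum by algebra+
    then show "A0 = u - v" "A1 = v - w" "A2 = w - u" by (metis three_cancel)+
  qed
  have "3 * w = 3 * (- (u + v))" using uvw by algebra
  then have "w = - (u + v)" by (rule three_cancel)
  have a: "weber_a A0 A1 A2 = u * v + v * w + w * u"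
  proof -
    have "A0 * A1 + A1 * A2 + A2 * A0 = 3 * (u * v + v * w + w * u)"
      unfolding A \<open>w = - (u + v)\<close> by algebra
    then show ?thesis using three_neq_0 by (simp add: weber_a_def)
  qed
  have b: "weber_b A0 A1 A2 = - (u * v * w)" by (simp add: weber_b_def u_def v_def w_def)
  have "4 * weber_a A0 A1 A2 ^ 3 + 27 * weber_b A0 A1 A2 ^ 2 = - ((A0 * A1 * A2) ^ 2)"
    unfolding a b unfolding A \<open>w = - (u + v)\<close> by algebra
  then show ?thesis using assms by (simp add: weber_roots_def)
qed

lemma weber_elliptic:
  assumes "weber_roots A0 A1 A2"
  shows "elliptic_curve (weber_a A0 A1 A2) (weber_b A0 A1 A2)"
  using power_not_zero[OF sixteen_neq_0, of 2]
  by (simp add: elliptic_curve_def weber_discriminant[OF assms])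

lemma weber_short_weierstrass:
  "weber_roots A0 A1 A2 \<Longrightarrow> short_weierstrass (weber_a A0 A1 A2) (weber_b A0 A1 A2)"
  by (simp add: short_weierstrass_def weber_elliptic two_neq_0 three_neq_0)

lemma weber_j_invariant:
  assumes "weber_roots A0 A1 A2"
  shows "j_invariant (weber_a A0 A1 A2) (weber_b A0 A1 A2) = - ((A0 * A1 + A1 * A2 + A2 * A0) ^ 3)"
proof -
  have a: "A0 * A1 + A1 * A2 + A2 * A0 = 3 * weber_a A0 A1 A2"
    by (simp add: weber_a_def three_neq_0)
  have "(256::'a) \<noteq> 0" using power_not_zero[OF sixteen_neq_0, of 2] by simp
  moreover have "1728 * (4 * x ^ 3) = - 256 * - ((3 * x) ^ 3)" for x :: 'a by algebra
  ultimately show ?thesis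
    unfolding a j_invariant_def weber_discriminant[OF assms] by simp
qed

lemma weber_2_torsion:
  assumes "A0 + A1 + A2 = 0"
  shows "Affine ((A0 - A2) / 3) 0 \<in> ec_points (weber_a A0 A1 A2) (weber_b A0 A1 A2)"
proof -
  define e where "e = (A0 - A2) / 3"
  have e: "3 * e = A0 - A2" unfolding e_def by (rule three_div_3)
  have a: "3 * weber_a A0 A1 A2 = A0 * A1 + A1 * A2 + A2 * A0" by (simp add: weber_a_def three_neq_0)
  have b: "27 * weber_b A0 A1 A2 = - ((A0 - A2) * (A1 - A0) * (A2 - A1))"
  proof -
    have "27 * - (x * y * z) = - ((3 * x) * (3 * y) * (3 * z))" for x y z :: 'a by algebra
    then show ?thesis unfolding weber_b_def by (simp only: three_div_3)
  qed
  have "27 * (e ^ 3 + weber_a A0 A1 A2 * e + weber_b A0 A1 A2) =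
      (3 * e) ^ 3 + 3 * (3 * weber_a A0 A1 A2) * (3 * e) + 27 * weber_b A0 A1 A2" by algebra
  also have "\<dots> = 0" unfolding e a b using assms by algebra
  finally have "3 ^ 3 * (e ^ 3 + weber_a A0 A1 A2 * e + weber_b A0 A1 A2) = 0" by simp
  then have "e ^ 3 + weber_a A0 A1 A2 * e + weber_b A0 A1 A2 = 0"
    using power_not_zero[OF three_neq_0, of 3] by (metis mult_eq_0_iff)
  then show ?thesis unfolding e_def[symmetric] ec_points_def by simp
qed

text \<open>On this curve multiplication by \<open>p\<close> is, up to sign, the Frobenius map of degree \<open>p\<^sup>2\<close>:
  the constant \<open>c\<close> of supersingular_mult_p satisfies \<open>c\<^sup>3 = 1\<close> because of the 2-torsion, as
  \<open>A\<^sub>0 A\<^sub>1 A\<^sub>2\<close> is rational, and \<open>c\<^sup>2 = 1\<close> because of the 3-torsion, as a cube root of the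
  discriminant is rational.\<close>

theorem weber_mult_p:
  assumes "weber_roots A0 A1 A2" "supersingular (weber_a A0 A1 A2) (weber_b A0 A1 A2)"
  defines "a \<equiv> weber_a A0 A1 A2" and "b \<equiv> weber_b A0 A1 A2"
  shows "A0 \<in> K" "A1 \<in> K" "A2 \<in> K"
    and "Affine x y \<in> ec_points a b \<Longrightarrow> \<exists>y'. ec_mult a p (Affine x y) = Affine (x ^ p ^ 2) y'"
proof -
  interpret short_weierstrass a b
    unfolding a_def b_def by (rule weber_short_weierstrass[OF assms(1)])
  have A: "A0 + A1 + A2 = 0" "A0 * A1 * A2 = 16" using assms(1) by (simp_all add: weber_roots_def)
  obtain c where c: "c \<noteq> 0"
    "\<And>x y. Affine x y \<in> E \<Longrightarrow> \<exists>y'. p \<odot> Affine x y = Affine (x ^ p ^ 2 / c) y'"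
    using supersingular_mult_p[OF CHAR_eq prime_p] assms(2) unfolding a_def b_def by metis
  have fix_x: "x ^ p ^ 2 = c * x"
    if "Affine x y \<in> E" "p \<odot> Affine x y = Affine x y \<or> p \<odot> Affine x y = ec_neg (Affine x y)" for x y
    using c(2)[OF that(1)] that(2) c(1) by (auto simp: field_simps)
  define e1 e2 e3 where "e1 = (A0 - A2) / 3" and "e2 = (A1 - A0) / 3" and "e3 = (A2 - A1) / 3"
  have e: "Affine e1 0 \<in> E" "Affine e2 0 \<in> E" "Affine e3 0 \<in> E"
  proof -
    have rotate: "weber_a A1 A2 A0 = a" "weber_b A1 A2 A0 = b" "weber_a A2 A0 A1 = a" "weber_b A2 A0 A1 = b"
      unfolding a_def b_def weber_a_def weber_b_def by (simp_all only: ac_simps)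
    have sum: "A1 + A2 + A0 = 0" "A2 + A0 + A1 = 0" using A(1) by algebra+
    show "Affine e1 0 \<in> E" "Affine e2 0 \<in> E" "Affine e3 0 \<in> E"
      using weber_2_torsion[OF A(1)] weber_2_torsion[OF sum(1)] weber_2_torsion[OF sum(2)]
      unfolding rotate by (simp_all only: e1_def e2_def e3_def a_def b_def)
  qed
  have A_eq: "A0 = e1 - e2" "A1 = e2 - e3" "A2 = e3 - e1"
  proof -
    have "3 * e1 = A0 - A2" "3 * e2 = A1 - A0" "3 * e3 = A2 - A1"
      unfolding e1_def e2_def e3_def by (rule three_div_3)+
    then have "3 * (e1 - e2) = 3 * A0" "3 * (e2 - e3) = 3 * A1" "3 * (e3 - e1) = 3 * A2"
      using A(1) by algebra+
    then show "A0 = e1 - e2" "A1 = e2 - e3" "A2 = e3 - e1" by (metis three_cancel)+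
  qed
  have e_frob: "e1 ^ p ^ 2 = c * e1" "e2 ^ p ^ 2 = c * e2" "e3 ^ p ^ 2 = c * e3"
    using fix_x e two_torsion_odd_mult[OF _ odd_p] by metis+
  have A_frob: "A0 ^ p ^ 2 = c * A0" "A1 ^ p ^ 2 = c * A1" "A2 ^ p ^ 2 = c * A2"
    unfolding A_eq frobenius_diff e_frob by (simp_all add: algebra_simps)
  have "(A0 * A1 * A2) ^ p ^ 2 = c ^ 3 * (A0 * A1 * A2)"
    unfolding power_mult_distrib A_frob by algebra
  moreover have "(16::'a) \<in> K" by (rule K_numeral)
  ultimately have c3: "c ^ 3 = 1" using A(2) sixteen_neq_0 by (simp add: Fq_iff)
  \<comment> \<open>These are the zeros of the 3-division polynomial divided by 3,
    \<open>x ^ 4 + 2 * a * x ^ 2 + 4 * b * x - a ^ 2 / 3\<close>, with multiplicity.\<close>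
  obtain x1 x2 x3 x4 where xs: "x1 + x2 + x3 + x4 = 0"
    "2 * a = x1 * x2 + x1 * x3 + x1 * x4 + x2 * x3 + x2 * x4 + x3 * x4"
    "4 * b = - (x1 * x2 * x3 + x1 * x2 * x4 + x1 * x3 * x4 + x2 * x3 * x4)"
    "- (a ^ 2) / 3 = x1 * x2 * x3 * x4"
    by (rule depressed_quartic_roots)
  have x4: "- (a ^ 2) = 3 * (x1 * x2 * x3 * x4)"
    using xs(4) three_neq_0 by (simp add: field_simps)
  have x_frob: "x ^ p ^ 2 = c * x" if "x = x1 \<or> x = x2 \<or> x = x3 \<or> x = x4" for x
  proof -
    obtain y where y: "Affine x y \<in> E" by (rule point_over_exists)
    have "(x - x1) * (x - x2) * (x - x3) * (x - x4) = 0" using that by auto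
    then have "3 * x ^ 4 + 6 * a * x ^ 2 + 12 * b * x - a ^ 2 = 0"
      using xs(1-3) x4 by algebra
    then have "3 \<odot> Affine x y = Infinity" by (rule three_torsion[OF y])
    moreover have "p mod 3 = 1 \<or> Suc (p mod 3) = 3" using not_3_dvd_p by presburger
    ultimately show ?thesis using fix_x[OF y] mult_of_torsion[OF y] by blast
  qed
  \<comment> \<open>Three times a zero of the resolvent cubic of this quartic, shifted to remove the
    quadratic term. For a 3-division polynomial the linear term then disappears too, so
    \<open>\<theta>\<close> is a cube root, namely of \<open>16 * (4 * a ^ 3 + 27 * b ^ 2)\<close>.
    Being quadratic in the \<open>x\<close>s, it is multiplied by \<open>c ^ 2\<close> under
    Frobenius.\<close>
  define \<theta> where "\<theta> = 3 * (x1 * x2 + x3 * x4) - (x1 * x2 + x1 * x3 + x1 * x4 + x2 * x3 + x2 * x4 + x3 * x4)"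
  have "(3::'a) \<in> K" by (rule K_numeral)
  then have three: "(3::'a) ^ p ^ 2 = 3" by (simp only: Fq_iff)
  have "\<theta> ^ p ^ 2 = c ^ 2 * \<theta>"
    unfolding \<theta>_def frobenius_diff frobenius_add power_mult_distrib three
    using x_frob[of x1] x_frob[of x2] x_frob[of x3] x_frob[of x4]
    by (simp add: algebra_simps power2_eq_square)
  have "\<theta> ^ 3 = 16 * (4 * a ^ 3 + 27 * b ^ 2)"
    using xs(1-3) x4 unfolding \<theta>_def by algebra
  also have "\<dots> = 16 * - 256" unfolding a_def b_def weber_discriminant[OF assms(1)] ..
  finally have \<theta>3: "\<theta> ^ 3 = - (16 ^ 3)" by simp
  then have "\<theta> \<noteq> 0" using power_not_zero[OF sixteen_neq_0, of 3] by auto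
  have "(\<theta> / 16) ^ 3 = - 1" using \<theta>3 power_not_zero[OF sixteen_neq_0, of 3] by (simp add: power_divide)
  then have "(\<theta> / 16) ^ 24 = 1" using power_mult[of "\<theta> / 16" 3 8] by simp
  then have "\<theta> / 16 \<in> K" by (rule root_of_unity_24)
  then have "\<theta> / 16 * 16 \<in> K" by (intro K_mult) simp_all
  then have "\<theta> \<in> K" using sixteen_neq_0 by simp
  then have "c ^ 2 = 1" using \<open>\<theta> ^ p ^ 2 = c ^ 2 * \<theta>\<close> \<open>\<theta> \<noteq> 0\<close> by (simp add: Fq_iff)
  then have "c = 1" using c3 by (simp add: power3_eq_cube power2_eq_square)
  show "A0 \<in> K" "A1 \<in> K" "A2 \<in> K"
    using A_frob \<open>c = 1\<close> by (simp_all add: Fq_iff)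
  show "\<exists>y'. p \<odot> Affine x y = Affine (x ^ p ^ 2) y'" if "Affine x y \<in> E"
    using c(2)[OF that] \<open>c = 1\<close> by simp
qed

text \<open>\<open>r\<^sub>0 r\<^sub>2\<close> is the difference of the first coordinates of two points \<open>P\<close>, \<open>2 P\<close> with \<open>4 P = 0\<close>.\<close>

lemma weber_4_torsion:
  assumes "weber_roots A0 A1 A2" "supersingular (weber_a A0 A1 A2) (weber_b A0 A1 A2)"
    and "r0 ^ 2 = A0" "r2 ^ 2 = - A2"
  defines "a \<equiv> weber_a A0 A1 A2" and "b \<equiv> weber_b A0 A1 A2"
  shows "r0 * r2 \<in> K"
proof -
  interpret short_weierstrass a b
    unfolding a_def b_def by (rule weber_short_weierstrass[OF assms(1)])
  have A: "A0 + A1 + A2 = 0" "A0 * A1 * A2 = 16" using assms(1) by (simp_all add: weber_roots_def)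
  define e where "e = (A0 - A2) / 3"
  have e3: "3 * e = A0 - A2" unfolding e_def by (rule three_div_3)
  have e: "Affine e 0 \<in> E" using weber_2_torsion[OF A(1)] by (simp only: e_def a_def b_def)
  have nz: "r0 \<noteq> 0" "r2 \<noteq> 0" using assms(3,4) A(2) sixteen_neq_0 by auto
  have "r0 ^ 2 - r2 ^ 2 \<noteq> 0"
    using A sixteen_neq_0 by (auto simp: assms(3,4) add_eq_0_iff)
  then have nz': "r0 + r2 \<noteq> 0" by (metis add_eq_0_iff2 power2_minus right_minus_eq)
  define m where "m = r0 * r2"
  have m2: "m ^ 2 = - (A0 * A2)" unfolding m_def power_mult_distrib assms(3,4) by simp
  have sum2: "(r0 + r2) ^ 2 = 3 * e + 2 * m" unfolding e3 m_def by (simp add: power2_sum assms(3,4))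
  have a: "a = m ^ 2 - 3 * e ^ 2"
  proof -
    have "3 * a = A0 * A1 + A1 * A2 + A2 * A0" by (simp add: a_def weber_a_def three_neq_0)
    then have "3 * a = 3 * (m ^ 2 - 3 * e ^ 2)" using e3 A(1) m2 by algebra
    then show ?thesis by (rule three_cancel)
  qed
  have b: "e ^ 3 + a * e + b = 0" using e by simp
  \<comment> \<open>A point whose double is \<open>(e, 0)\<close>: the differences of
    \<open>e\<close> to the other two roots are \<open>A0\<close> and \<open>- A2\<close>, and
    \<open>m\<close> is a square root of their product. The tangent at the point passes through
    \<open>(e, 0)\<close> with slope \<open>r0 + r2\<close>.\<close>
  define x y where "x = e + m" and "y = m * (r0 + r2)"
  have "y ^ 2 = m ^ 2 * (3 * e + 2 * m)" unfolding y_def power_mult_distrib sum2 ..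
  also have "\<dots> = x ^ 3 + a * x + b" using a b unfolding x_def by algebra
  finally have P: "Affine x y \<in> E" by simp
  have slope: "y = y + (r0 + r2) * (x - x)" "(r0 + r2) * (y + y) = x ^ 2 + x * x + x ^ 2 + a"
  proof -
    show "y = y + (r0 + r2) * (x - x)" by simp
    show "(r0 + r2) * (y + y) = x ^ 2 + x * x + x ^ 2 + a"
      using sum2 a unfolding x_def y_def by algebra
  qed
  have ne: "\<not> (x = x \<and> y = - y)" using nz nz' eq_uminus_self_iff[of y] by (simp add: y_def m_def)
  have x': "(r0 + r2) ^ 2 - x - x = e" unfolding sum2 x_def by simp
  have "Affine x y \<oplus> Affine x y = Affine e 0"
    unfolding ec_add_Affine[OF slope ne] x' by (simp add: x_def y_def)
  then have "2 \<odot> Affine x y = Affine e 0"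
    by (simp add: numeral_2_eq_2 ec_mult_Suc del: ec_add.simps(3))
  moreover have "2 \<odot> Affine e 0 = Infinity" by (simp add: numeral_2_eq_2 ec_mult_Suc)
  ultimately have "4 \<odot> Affine x y = Infinity" using ec_mult_mult[OF P, of 2 2] by simp
  moreover have "p mod 4 = 1 \<or> Suc (p mod 4) = 4" using odd_p by presburger
  ultimately have "p \<odot> Affine x y = Affine x y \<or> p \<odot> Affine x y = ec_neg (Affine x y)"
    using mult_of_torsion[OF P] by blast
  moreover obtain y' where "p \<odot> Affine x y = Affine (x ^ p ^ 2) y'"
    using weber_mult_p(4)[OF assms(1,2)] P unfolding a_def b_def by blast
  ultimately have "x \<in> K" by (auto simp: Fq_iff)
  moreover have "e \<in> K"
    using weber_mult_p(1,3)[OF assms(1,2)] unfolding e_def by (intro K_intros) simp_all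
  ultimately have "x - e \<in> K" by (rule K_diff)
  then show ?thesis by (simp add: x_def m_def)
qed

end

subsection \<open>Rationality of the coordinates\<close>

locale weber_curve = char_not_2_3 p ty
  for p and ty :: "'a::alg_closed_field itself" +
  fixes s :: 'a
  assumes s_square: "s ^ 2 = 2"
begin

lemma s_in_K: "s \<in> K" and s_neq_0: "s \<noteq> 0"
  using sqrt_2_in_K s_square two_neq_0 by auto

lemma two_cancel: "2 * x = 2 * y \<Longrightarrow> x = (y::'a)"
  using two_neq_0 by (metis mult_left_cancel)

lemma two_div_2: "2 * ((x::'a) / 2) = x"
  using two_neq_0 by simp

text \<open>The affine part of the curve over supersingular values of \<open>j\<close>, the latter expressed
  symmetrically in the coordinates.\<close>

definition supersingular_weber :: "'a \<Rightarrow> 'a \<Rightarrow> 'a \<Rightarrow> bool" where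
  "supersingular_weber u0 u1 u2 \<longleftrightarrow> u0 ^ 8 + u1 ^ 8 + u2 ^ 8 = 0 \<and> u0 * u1 * u2 = s \<and>
     supersingular_j (- ((u0 ^ 8 * u1 ^ 8 + u1 ^ 8 * u2 ^ 8 + u2 ^ 8 * u0 ^ 8) ^ 3))"

lemma supersingular_weber_rotate:
  "supersingular_weber u0 u1 u2 \<Longrightarrow> supersingular_weber u1 u2 u0"
  by (simp only: supersingular_weber_def ac_simps)

lemma supersingular_weber_swap:
  "supersingular_weber u0 u1 u2 \<Longrightarrow> supersingular_weber u0 u2 u1"
  by (simp only: supersingular_weber_def ac_simps)

lemma prod_power:
  assumes "u0 * u1 * u2 = s"
  shows "u0 ^ 2 * u1 ^ 2 * u2 ^ 2 = 2" "u0 ^ 4 * u1 ^ 4 * u2 ^ 4 = 4" "u0 ^ 8 * u1 ^ 8 * u2 ^ 8 = 16"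
proof -
  show *: "u0 ^ 2 * u1 ^ 2 * u2 ^ 2 = 2"
    using assms s_square by (simp flip: power_mult_distrib)
  have "u0 ^ 4 * u1 ^ 4 * u2 ^ 4 = (u0 ^ 2 * u1 ^ 2 * u2 ^ 2) ^ 2"
    "u0 ^ 8 * u1 ^ 8 * u2 ^ 8 = (u0 ^ 2 * u1 ^ 2 * u2 ^ 2) ^ 4"
    by algebra+
  then show "u0 ^ 4 * u1 ^ 4 * u2 ^ 4 = 4" "u0 ^ 8 * u1 ^ 8 * u2 ^ 8 = 16" unfolding * by simp_all
qed

lemma supersingular_weber_roots:
  "supersingular_weber u0 u1 u2 \<Longrightarrow> weber_roots (u0 ^ 8) (u1 ^ 8) (u2 ^ 8)"
  by (simp add: supersingular_weber_def weber_roots_def prod_power)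

lemma supersingular_weber_iff:
  assumes "weber_roots (u0 ^ 8) (u1 ^ 8) (u2 ^ 8)" "u0 * u1 * u2 = s"
  shows "supersingular_weber u0 u1 u2 \<longleftrightarrow>
    supersingular (weber_a (u0 ^ 8) (u1 ^ 8) (u2 ^ 8)) (weber_b (u0 ^ 8) (u1 ^ 8) (u2 ^ 8))"
  using supersingular_j_iff[OF two_neq_0 three_neq_0 weber_elliptic[OF assms(1)]] assms
  unfolding weber_j_invariant[OF assms(1)] by (simp add: supersingular_weber_def weber_roots_def)

lemma supersingular_weber_imp_supersingular:
  assumes "supersingular_weber u0 u1 u2"
  shows "supersingular (weber_a (u0 ^ 8) (u1 ^ 8) (u2 ^ 8)) (weber_b (u0 ^ 8) (u1 ^ 8) (u2 ^ 8))"
  using assms supersingular_weber_iff[OF supersingular_weber_roots[OF assms]]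
  by (simp add: supersingular_weber_def)

lemma coordinates_neq_0:
  assumes "supersingular_weber u0 u1 u2"
  shows "u0 \<noteq> 0" "u1 \<noteq> 0" "u2 \<noteq> 0"
  using assms s_neq_0 by (auto simp: supersingular_weber_def)

text \<open>The 4-torsion shows that \<open>i * u0 ^ 4 * u2 ^ 4\<close> is rational, and its product
  with \<open>u1 ^ 4\<close> is \<open>4 * i\<close>.\<close>

lemma fourth_power_in_K_aux:
  assumes "supersingular_weber u0 u1 u2"
  shows "u1 ^ 4 \<in> K"
proof -
  obtain i :: 'a where i: "i ^ 2 = - 1" using nth_root_exists[of 2 "- 1"] by auto
  then have "i \<noteq> 0" by auto
  have 1: "u0 ^ 4 * (i * u2 ^ 4) \<in> K"
  proof (rule weber_4_torsion)
    show "weber_roots (u0 ^ 8) (u1 ^ 8) (u2 ^ 8)" using assms by (rule supersingular_weber_roots)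
    show "supersingular (weber_a (u0 ^ 8) (u1 ^ 8) (u2 ^ 8)) (weber_b (u0 ^ 8) (u1 ^ 8) (u2 ^ 8))"
      using assms by (rule supersingular_weber_imp_supersingular)
    show "(u0 ^ 4) ^ 2 = u0 ^ 8" by simp
    show "(i * u2 ^ 4) ^ 2 = - (u2 ^ 8)" by (simp add: power_mult_distrib i)
  qed
  have "u0 ^ 4 * (i * u2 ^ 4) * u1 ^ 4 = i * (u0 ^ 4 * u1 ^ 4 * u2 ^ 4)" by algebra
  then have "u0 ^ 4 * (i * u2 ^ 4) * u1 ^ 4 = i * 4"
    using assms by (simp only: supersingular_weber_def prod_power)
  then have 2: "u0 ^ 4 * (i * u2 ^ 4) * u1 ^ 4 \<in> K"
    using sqrt_minus_1_in_K[OF i] by (simp only: K_mult K_numeral)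
  show ?thesis
    by (rule K_mult_cancel[OF 2 1]) (use coordinates_neq_0[OF assms] \<open>i \<noteq> 0\<close> in simp)
qed

lemma fourth_power_in_K:
  assumes "supersingular_weber u0 u1 u2"
  shows "u0 ^ 4 \<in> K" "u1 ^ 4 \<in> K" "u2 ^ 4 \<in> K"
  using assms fourth_power_in_K_aux supersingular_weber_rotate by blast+

text \<open>Origin of the formulas: in the quotient of the curve of the \<open>u\<close>s by its
  point \<open>((u0 ^ 8 - u2 ^ 8) / 3, 0)\<close>, the roots differ by \<open>(r0 + r2) ^ 2\<close>,
  \<open>- ((r0 - r2) ^ 2)\<close> and \<open>- 4 * r0 * r2\<close>, up to order and sign. Scaling
  by \<open>r0 * r2 / 4\<close> gives the product 16. The proof uses the isogeny back: the curve of
  the \<open>v\<close>s maps onto a scaled copy of the curve of the \<open>u\<close>s.\<close>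

lemma weber_isogeny:
  assumes u: "supersingular_weber u0 u1 u2"
    and r: "r0 = u0 ^ 4" "r2 = i * u2 ^ 4" "i ^ 2 = - 1"
    and v: "4 * v0 ^ 8 = r0 * r2 * (r0 + r2) ^ 2" "4 * v2 ^ 8 = - (r0 * r2 * (r0 - r2) ^ 2)"
      "v0 * v1 * v2 = s"
  shows "supersingular_weber v0 v1 v2"
proof -
  define m S D where "m = r0 * r2" and "S = r0 ^ 2 + r2 ^ 2" and "D = r0 ^ 2 - r2 ^ 2"
  define A0 A1 A2 where "A0 = u0 ^ 8" and "A1 = u1 ^ 8" and "A2 = u2 ^ 8"
  define B0 B1 B2 where "B0 = v0 ^ 8" and "B1 = v1 ^ 8" and "B2 = v2 ^ 8"
  have rootsA: "weber_roots A0 A1 A2"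
    using supersingular_weber_roots[OF u] by (simp add: A0_def A1_def A2_def)
  have A_sum: "A0 + A1 + A2 = 0" and A_prod: "A0 * A1 * A2 = 16"
    using rootsA by (simp_all add: weber_roots_def)
  have A: "A0 = r0 ^ 2" "A2 = - (r2 ^ 2)"
    using r(3) by (simp_all add: A0_def A2_def r power_mult_distrib)
  have A1: "A1 = - D" using A_sum unfolding A D_def by algebra
  have B_prod: "B0 * B1 * B2 = 16" using prod_power(3)[OF v(3)] by (simp add: B0_def B1_def B2_def)
  have B: "4 * B0 = m * (r0 + r2) ^ 2" "4 * B2 = - (m * (r0 - r2) ^ 2)"
    using v by (simp_all add: B0_def B2_def m_def)
  have nz: "(4::'a) \<noteq> 0" "(48::'a) \<noteq> 0" "(216::'a) \<noteq> 0"
    using power_not_zero[OF two_neq_0, of 2] no_zero_divisors[OF sixteen_neq_0 three_neq_0]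
      no_zero_divisors[OF power_not_zero[OF two_neq_0, of 3] power_not_zero[OF three_neq_0, of 3]]
    by simp_all
  have "m ^ 2 * D = A0 * A1 * A2" unfolding A A1 m_def by algebra
  then have mD: "m ^ 2 * D = 16" using A_prod by simp
  have B02: "16 * (B0 * B2) = - (m ^ 2 * D ^ 2)"
  proof -
    have "16 * (B0 * B2) = (4 * B0) * (4 * B2)" by algebra
    then show ?thesis unfolding B D_def by algebra
  qed
  have B1: "B1 = - (m ^ 2)"
  proof -
    have mD2: "m ^ 2 * D ^ 2 = - (16 * (B0 * B2))" using B02 by simp
    have "B0 * B2 * B1 = 16" using B_prod by (simp add: mult_ac)
    have "16 * (D * (B1 + m ^ 2)) = m ^ 2 * D * (D * (B1 + m ^ 2))" using mD by simp
    also have "\<dots> = m ^ 2 * D ^ 2 * B1 + (m ^ 2 * D) ^ 2" by algebra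
    also have "\<dots> = - (16 * (B0 * B2 * B1)) + 16 ^ 2" unfolding mD2 mD by simp
    also have "\<dots> = 0" unfolding \<open>B0 * B2 * B1 = 16\<close> by simp
    finally have "D * (B1 + m ^ 2) = 0" using sixteen_neq_0 by (metis mult_eq_0_iff)
    moreover have "D \<noteq> 0" using mD sixteen_neq_0 by auto
    ultimately show ?thesis by (simp add: eq_neg_iff_add_eq_0)
  qed
  have "4 * (B0 + B1 + B2) = 4 * 0" using B unfolding B1 m_def by algebra
  then have B_sum: "B0 + B1 + B2 = 0" by (rule mult_left_cancel[THEN iffD1, OF nz(1)])
  have rootsB: "weber_roots B0 B1 B2" using B_sum B_prod by (simp add: weber_roots_def)
  define e where "e = (B0 - B2) / 3"
  interpret W: short_weierstrass "weber_a B0 B1 B2" "weber_b B0 B1 B2"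
    by (rule weber_short_weierstrass[OF rootsB])
  interpret two_isogeny "weber_a B0 B1 B2" "weber_b B0 B1 B2" e
    by unfold_locales (use weber_2_torsion[OF B_sum] in \<open>simp add: e_def\<close>)
  have e: "6 * e = m * S"
  proof -
    have "3 * e = B0 - B2" unfolding e_def by (rule three_div_3)
    then have "2 * (6 * e) = 2 * (m * S)" using B unfolding S_def by algebra
    then show ?thesis by (rule two_cancel)
  qed
  have SD: "S ^ 2 = D ^ 2 + 4 * m ^ 2" unfolding S_def D_def m_def by algebra
  have aB: "3 * weber_a B0 B1 B2 = B0 * B1 + B1 * B2 + B2 * B0"
    and aA: "3 * weber_a A0 A1 A2 = - (m ^ 2) - D ^ 2"
  proof -
    show "3 * weber_a B0 B1 B2 = B0 * B1 + B1 * B2 + B2 * B0" by (simp add: weber_a_def three_neq_0)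
    have "3 * weber_a A0 A1 A2 = A0 * A1 + A1 * A2 + A2 * A0" by (simp add: weber_a_def three_neq_0)
    then show "3 * weber_a A0 A1 A2 = - (m ^ 2) - D ^ 2" unfolding A A1 D_def m_def by algebra
  qed
  have t16: "16 * t = m ^ 2 * D ^ 2"
  proof -
    have "48 * weber_a B0 B1 B2 = - 16 * m ^ 4 - m ^ 2 * D ^ 2"
      using aB B_sum B02 B1 by algebra
    moreover have "48 * t = 4 * (6 * e) ^ 2 + 48 * weber_a B0 B1 B2" unfolding t_def by algebra
    ultimately have "3 * (16 * t) = 3 * (m ^ 2 * D ^ 2)" unfolding e using SD by algebra
    then show ?thesis by (rule three_cancel)
  qed
  have a': "a' = m ^ 2 * weber_a A0 A1 A2"
  proof -
    have "48 * a' = 48 * (m ^ 2 * weber_a A0 A1 A2)"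
      using aA aB B_sum B02 B1 t16 unfolding a'_def by algebra
    then show ?thesis by (rule mult_left_cancel[THEN iffD1, OF nz(2)])
  qed
  have b': "b' = - (m ^ 3 * weber_b A0 A1 A2)"
  proof -
    have "216 * b' = 2 * (6 * e) * ((6 * e) ^ 2 - 9 * (16 * t))"
      using b_eq unfolding b'_def by algebra
    also have "\<dots> = 2 * m ^ 3 * S * (S ^ 2 - 9 * D ^ 2)" unfolding e t16 by algebra
    finally have 1: "216 * b' = 2 * m ^ 3 * S * (S ^ 2 - 9 * D ^ 2)" .
    define f where "f = (A0 - A2) / 3"
    have f: "3 * f = S" unfolding f_def three_div_3 A S_def by simp
    have "f ^ 3 + weber_a A0 A1 A2 * f + weber_b A0 A1 A2 = 0"
      using weber_2_torsion[OF A_sum] unfolding ec_points_def f_def[symmetric] by simp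
    then have "216 * weber_b A0 A1 A2 = - 8 * (3 * f) ^ 3 - 24 * (3 * weber_a A0 A1 A2) * (3 * f)"
      by algebra
    then have "216 * weber_b A0 A1 A2 = - 2 * S * (S ^ 2 - 9 * D ^ 2)"
      unfolding f aA using SD by algebra
    then have "216 * b' = 216 * (- (m ^ 3 * weber_b A0 A1 A2))" using 1 by algebra
    then show ?thesis by (rule mult_left_cancel[THEN iffD1, OF nz(3)])
  qed
  \<comment> \<open>Scaling by \<open>\<tau>\<close> turns the curve of the \<open>u\<close>s into
    the image curve \<open>a'\<close>, \<open>b'\<close>.\<close>
  obtain \<tau> where \<tau>: "\<tau> ^ 2 = - m" using nth_root_exists[of 2 "- m"] by auto
  have "\<tau> ^ 4 = m ^ 2" "\<tau> ^ 6 = - (m ^ 3)" using \<tau> by algebra+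
  moreover have "\<tau> \<noteq> 0" using \<tau> mD sixteen_neq_0 by auto
  ultimately have "supersingular a' b'"
    using supersingular_scale[OF supersingular_weber_imp_supersingular[OF u], of \<tau>]
    unfolding a' b' by (simp add: A0_def A1_def A2_def)
  then have "supersingular (weber_a B0 B1 B2) (weber_b B0 B1 B2)"
    using supersingular_if_image odd_p CHAR_eq by simp
  then show ?thesis
    using supersingular_weber_iff[of v0 v1 v2] rootsB v(3) by (simp add: B0_def B1_def B2_def)
qed

text \<open>The sum is a factor of \<open>u0 ^ 8 + u2 ^ 8\<close>, which is
  \<open>- (u1 ^ 8)\<close>.\<close>

lemma fourth_powers_neq:
  assumes "supersingular_weber u0 u1 u2" "z ^ 4 = - 1"
  shows "u0 ^ 4 + z ^ 2 * u2 ^ 4 \<noteq> 0"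
proof
  assume "u0 ^ 4 + z ^ 2 * u2 ^ 4 = 0"
  then have "u1 ^ 8 = 0"
    using assms unfolding supersingular_weber_def by algebra
  then show False using coordinates_neq_0[OF assms(1)] by simp
qed

text \<open>Square roots are taken in the formulas of \<open>weber_isogeny\<close> with
  \<open>i = z ^ 2\<close>: \<open>z * u0 ^ 2 * u2 ^ 2\<close> is a root of \<open>r0 * r2\<close>,
  and the minus sign is absorbed by \<open>z ^ 4\<close>. The signs can be prescribed since
  \<open>v0\<close> and \<open>v2\<close> are chosen only afterwards; \<open>v1\<close> is then
  forced by the product.\<close>

lemma isogenous_point:
  assumes u: "supersingular_weber u0 u1 u2" and z: "z ^ 4 = - 1"
  obtains v0 v1 v2 where "supersingular_weber v0 v1 v2"
    "2 * v0 ^ 4 = z * u0 ^ 2 * u2 ^ 2 * (u0 ^ 4 + z ^ 2 * u2 ^ 4)"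
    "2 * v2 ^ 4 = z ^ 3 * u0 ^ 2 * u2 ^ 2 * (u0 ^ 4 - z ^ 2 * u2 ^ 4)"
proof -
  obtain v0 where "v0 ^ 4 = z * u0 ^ 2 * u2 ^ 2 * (u0 ^ 4 + z ^ 2 * u2 ^ 4) / 2"
    using nth_root_exists[OF zero_less_numeral] by blast
  then have v0: "2 * v0 ^ 4 = z * u0 ^ 2 * u2 ^ 2 * (u0 ^ 4 + z ^ 2 * u2 ^ 4)"
    by (simp only: two_div_2)
  obtain v2 where "v2 ^ 4 = z ^ 3 * u0 ^ 2 * u2 ^ 2 * (u0 ^ 4 - z ^ 2 * u2 ^ 4) / 2"
    using nth_root_exists[OF zero_less_numeral] by blast
  then have v2: "2 * v2 ^ 4 = z ^ 3 * u0 ^ 2 * u2 ^ 2 * (u0 ^ 4 - z ^ 2 * u2 ^ 4)"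
    by (simp only: two_div_2)
  have "z \<noteq> 0" using z by auto
  have "u0 ^ 4 - z ^ 2 * u2 ^ 4 \<noteq> 0"
  proof -
    have "(z ^ 3) ^ 4 = - 1" "(z ^ 3) ^ 2 = - (z ^ 2)" using z by algebra+
    then show ?thesis using fourth_powers_neq[OF u, of "z ^ 3"] by simp
  qed
  then have "2 * v0 ^ 4 \<noteq> 0" "2 * v2 ^ 4 \<noteq> 0"
    unfolding v0 v2 using fourth_powers_neq[OF u z] coordinates_neq_0[OF u] \<open>z \<noteq> 0\<close> by simp_all
  then have nz: "v0 \<noteq> 0" "v2 \<noteq> 0" by auto
  show ?thesis
  proof (rule that[OF _ v0 v2])
    show "supersingular_weber v0 (s / (v0 * v2)) v2"
    proof (rule weber_isogeny[OF u refl refl])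
      show "(z ^ 2) ^ 2 = - 1" using z by simp
      show "4 * v0 ^ 8 = u0 ^ 4 * (z ^ 2 * u2 ^ 4) * (u0 ^ 4 + z ^ 2 * u2 ^ 4) ^ 2"
        using v0 by algebra
      show "4 * v2 ^ 8 = - (u0 ^ 4 * (z ^ 2 * u2 ^ 4) * (u0 ^ 4 - z ^ 2 * u2 ^ 4) ^ 2)"
        using v2 z by algebra
      show "v0 * (s / (v0 * v2)) * v2 = s" using nz by simp
    qed
  qed
qed

text \<open>\<open>2 * v0 ^ 4\<close> is rational for the isogenous point. Multiplied by
  \<open>u1 ^ 2\<close>, its factor \<open>u0 ^ 2 * u2 ^ 2\<close> becomes the constant 2, and only
  fourth powers remain.\<close>

lemma square_in_K_aux:
  assumes u: "supersingular_weber u0 u1 u2"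
  shows "u1 ^ 2 \<in> K"
proof -
  obtain z :: 'a where z: "z ^ 4 = - 1" using nth_root_exists[of 4 "- 1"] by auto
  then have "z \<noteq> 0" by auto
  obtain v0 v1 v2 where v: "supersingular_weber v0 v1 v2"
    "2 * v0 ^ 4 = z * u0 ^ 2 * u2 ^ 2 * (u0 ^ 4 + z ^ 2 * u2 ^ 4)"
    using isogenous_point[OF u z] by metis
  define w where "w = 2 * v0 ^ 4"
  have 1: "w \<in> K" unfolding w_def using fourth_power_in_K[OF v(1)] by (intro K_mult) simp_all
  have "w * u1 ^ 2 = u0 ^ 2 * u1 ^ 2 * u2 ^ 2 * z * (u0 ^ 4 + z ^ 2 * u2 ^ 4)"
    unfolding w_def v(2) by algebra
  then have "w * u1 ^ 2 = 2 * z * (u0 ^ 4 + z ^ 2 * u2 ^ 4)"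
    using u by (simp only: supersingular_weber_def prod_power)
  then have 2: "w * u1 ^ 2 \<in> K"
    using fourth_power_in_K[OF u] eighth_root_in_K[OF z] by (simp add: K_intros)
  have "w \<noteq> 0"
    using fourth_powers_neq[OF u z] coordinates_neq_0[OF u] \<open>z \<noteq> 0\<close> unfolding w_def v(2) by simp
  then show ?thesis by (rule K_mult_cancel[OF 2 1])
qed

lemma square_in_K:
  assumes "supersingular_weber u0 u1 u2"
  shows "u0 ^ 2 \<in> K" "u1 ^ 2 \<in> K" "u2 ^ 2 \<in> K"
  using assms square_in_K_aux supersingular_weber_rotate by blast+

text \<open>With the squares of the coordinates of all supersingular points in \<open>K\<close>, the isogenous
  points show that certain products of \<open>u\<^sub>0\<^sup>4 + z\<^sup>2 u\<^sub>1\<^sup>4\<close> with monomials are squares in \<open>K\<close>;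
  comparing two of them shows that \<open>(u\<^sub>2 / u\<^sub>1)\<^sup>2\<close> is a square in \<open>K\<close>.\<close>

lemma coordinate_ratio_in_K:
  assumes u: "supersingular_weber u0 u1 u2"
  obtains k where "k \<in> K" "u2 = k * u1"
proof -
  obtain z :: 'a where z: "z ^ 4 = - 1" using nth_root_exists[of 4 "- 1"] by auto
  then have "z \<noteq> 0" by auto
  have prod: "u0 ^ 2 * u1 ^ 2 * u2 ^ 2 = 2" "u0 ^ 4 * u1 ^ 4 * u2 ^ 4 = 4" and sum: "u0 ^ 8 + u1 ^ 8 + u2 ^ 8 = 0"
    using u prod_power by (simp_all add: supersingular_weber_def)
  obtain v0 v1 v2 where v: "supersingular_weber v0 v1 v2"
    "2 * v0 ^ 4 = z * u0 ^ 2 * u2 ^ 2 * (u0 ^ 4 + z ^ 2 * u2 ^ 4)"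
    "2 * v2 ^ 4 = z ^ 3 * u0 ^ 2 * u2 ^ 2 * (u0 ^ 4 - z ^ 2 * u2 ^ 4)"
    using isogenous_point[OF u z] .
  \<comment> \<open>In \<open>V ^ 2\<close> the outer terms add up to
    \<open>z * u0 ^ 6 * u2 ^ 2\<close>, and the middle term is \<open>2 * z ^ 3 * u1 ^ 2\<close> up
    to sign. Writing this 2 as \<open>u0 ^ 2 * u1 ^ 2 * u2 ^ 2\<close> shows the shape of an isogeny
    formula with \<open>u1 ^ 4\<close> in place of \<open>u2 ^ 4\<close>.\<close>
  define V where "V = v0 ^ 2 + z ^ 3 * v2 ^ 2"
  have VK: "V \<in> K"
    unfolding V_def using square_in_K[OF v(1)] eighth_root_in_K[OF z] by (simp add: K_intros)
  have "2 * (v0 ^ 4 + z ^ 6 * v2 ^ 4) = 2 * (z * u0 ^ 6 * u2 ^ 2)" using v(2,3) z by algebra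
  then have V1: "v0 ^ 4 + z ^ 6 * v2 ^ 4 = z * u0 ^ 6 * u2 ^ 2" by (rule two_cancel)
  have "2 * (2 * (v0 ^ 4 * v2 ^ 4)) = (2 * v0 ^ 4) * (2 * v2 ^ 4)" by algebra
  also have "\<dots> = 2 * (2 * u1 ^ 4)" unfolding v(2,3) using z prod(2) sum by algebra
  finally have "v0 ^ 4 * v2 ^ 4 = u1 ^ 4" by (rule two_cancel[OF two_cancel])
  then have "(z ^ 3 * v0 ^ 2 * v2 ^ 2) ^ 2 = (z ^ 3 * u1 ^ 2) ^ 2" by algebra
  then have "z ^ 3 * v0 ^ 2 * v2 ^ 2 = z ^ 3 * u1 ^ 2 \<or> z ^ 3 * v0 ^ 2 * v2 ^ 2 = - (z ^ 3 * u1 ^ 2)"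
    by (simp only: power2_eq_iff)
  \<comment> \<open>The sign of \<open>v0 ^ 2 * v2 ^ 2\<close> is not under control, so the eighth
    root \<open>z'\<close> is adapted to it: \<open>z\<close> or \<open>z ^ 3\<close>. Their
    quotient \<open>z ^ 2\<close> is a square in \<open>K\<close>, which the comparison below
    needs.\<close>
  then obtain y z' where y: "y \<in> K" "z' = z * y ^ 2" "z' ^ 4 = - 1"
    and w: "V ^ 2 = z * u0 ^ 2 * u2 ^ 2 * (u0 ^ 4 + z' ^ 2 * u1 ^ 4)"
  proof
    assume "z ^ 3 * v0 ^ 2 * v2 ^ 2 = z ^ 3 * u1 ^ 2"
    then have "V ^ 2 = z * u0 ^ 2 * u2 ^ 2 * (u0 ^ 4 + z ^ 2 * u1 ^ 4)"
      unfolding V_def using V1 prod(1) z by algebra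
    then show thesis using z by (intro that[of 1 z]) simp_all
  next
    assume "z ^ 3 * v0 ^ 2 * v2 ^ 2 = - (z ^ 3 * u1 ^ 2)"
    then have "V ^ 2 = z * u0 ^ 2 * u2 ^ 2 * (u0 ^ 4 + (z ^ 3) ^ 2 * u1 ^ 4)"
      unfolding V_def using V1 prod(1) z by algebra
    moreover have "(z ^ 3) ^ 4 = - 1" using z by algebra
    moreover have "z ^ 3 = z * z ^ 2" by (simp add: power3_eq_cube power2_eq_square mult.assoc)
    ultimately show thesis using eighth_root_in_K[OF z] by (intro that[of z "z ^ 3"]) simp_all
  qed
  have u': "supersingular_weber u0 u2 u1" using u by (rule supersingular_weber_swap)
  obtain t0 t1 t2 where t: "supersingular_weber t0 t1 t2"
    "2 * t0 ^ 4 = z' * u0 ^ 2 * u1 ^ 2 * (u0 ^ 4 + z' ^ 2 * u1 ^ 4)"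
    using isogenous_point[OF u' y(3)] by metis
  have "z * (V * y * u1) ^ 2 = z * (s * t0 ^ 2 * u2) ^ 2"
    using w t(2) y(2) s_square by algebra
  then have "(V * y * u1) ^ 2 = (s * t0 ^ 2 * u2) ^ 2"
    by (rule mult_left_cancel[THEN iffD1, OF \<open>z \<noteq> 0\<close>])
  then have "s * t0 ^ 2 * u2 = V * y * u1 \<or> s * t0 ^ 2 * u2 = - (V * y) * u1"
    by (metis minus_mult_left minus_minus power2_eq_iff)
  moreover have "s * t0 ^ 2 \<noteq> 0" using s_neq_0 coordinates_neq_0[OF t(1)] by simp
  ultimately have "u2 = V * y / (s * t0 ^ 2) * u1 \<or> u2 = - (V * y) / (s * t0 ^ 2) * u1"
    by (auto simp: field_simps)
  moreover have "V * y / (s * t0 ^ 2) \<in> K" "- (V * y) / (s * t0 ^ 2) \<in> K"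
    using VK y(1) s_in_K square_in_K[OF t(1)] by (simp_all add: K_intros)
  ultimately show ?thesis using that by blast
qed

text \<open>Rational ratios and squares leave a common sign open. It is settled by the product of
  the coordinates, which has odd degree: it is \<open>u1 ^ 3\<close> times two ratios, and equals
  \<open>s\<close>.\<close>

lemma coordinate_in_K:
  assumes u: "supersingular_weber u0 u1 u2"
  shows "u1 \<in> K"
proof -
  have u': "supersingular_weber u2 u1 u0"
    using u supersingular_weber_rotate supersingular_weber_swap by blast
  obtain k l where kl: "k \<in> K" "u2 = k * u1" "l \<in> K" "u0 = l * u1"
    using coordinate_ratio_in_K[OF u] coordinate_ratio_in_K[OF u'] by metis
  have s: "k * l * u1 ^ 2 * u1 = s"
    using u kl(2,4) unfolding supersingular_weber_def by algebra
  then have "k * l * u1 ^ 2 \<noteq> 0" using s_neq_0 by auto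
  moreover have "k * l * u1 ^ 2 \<in> K" using kl(1,3) square_in_K[OF u] by (simp add: K_intros)
  ultimately show ?thesis using s s_in_K K_mult_cancel by metis
qed

theorem supersingular_weber_in_K:
  assumes "supersingular_weber u0 u1 u2"
  shows "u0 \<in> K" "u1 \<in> K" "u2 \<in> K"
  using assms coordinate_in_K supersingular_weber_rotate by blast+

lemma supersingular_weberI:
  assumes "u0 ^ 8 + u1 ^ 8 + u2 ^ 8 = 0" "u0 * u1 * u2 = s" "supersingular_j (j_of_weber u0)"
  shows "supersingular_weber u0 u1 u2"
proof -
  define A B C where "A = u0 ^ 8" and "B = u1 ^ 8" and "C = u2 ^ 8"
  have "u0 ^ 24 = A ^ 3" by (simp add: A_def flip: power_mult)
  have "A + B + C = 0" "A * B * C = 16"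
    using assms(1) prod_power(3)[OF assms(2)] by (simp_all add: A_def B_def C_def)
  define \<sigma> where "\<sigma> = A * B + B * C + C * A"
  have "A ^ 3 - A * B * C = A * - \<sigma>" unfolding \<sigma>_def using \<open>A + B + C = 0\<close> by algebra
  then have "A ^ 3 - 16 = A * - \<sigma>" unfolding \<open>A * B * C = 16\<close> .
  moreover have "A \<noteq> 0" using \<open>A * B * C = 16\<close> sixteen_neq_0 by auto
  ultimately have "j_of_weber u0 = - (\<sigma> ^ 3)"
    unfolding j_of_weber_def \<open>u0 ^ 24 = A ^ 3\<close> by (simp add: power_mult_distrib)
  then show ?thesis
    using assms unfolding supersingular_weber_def A_def B_def C_def \<sigma>_def by simp
qed

end

theorem theorem13:
  fixes p :: nat and sqrt2 :: "'a::alg_closed_field"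
  assumes "prime p" and "\<not> p dvd 6"
    and "is_alg_closure_Fp p TYPE('a)"
    and "sqrt2 ^ 2 = 2"
  shows "\<forall>P \<in> supersingular_weber_invariants sqrt2. proj3_rational (Fq (p ^ 2)) P"
proof -
  interpret weber_curve p "TYPE('a)" sqrt2
    using assms by unfold_locales (simp_all add: is_alg_closure_Fp_def)
  have "proj3_rational K P" if "on_W24 sqrt2 P" "\<not> at_infinity3 P" "supersingular_j (W24_j P)" for P
    using that
  proof (transfer fixing: sqrt2 p)
    fix X :: "'a \<times> 'a \<times> 'a \<times> 'a"
    obtain X0 X1 X2 X3 where X: "X = (X0, X1, X2, X3)" by (cases X)
    assume 0: "case X of (X0, X1, X2, X3) \<Rightarrow> X0 ^ 8 + X1 ^ 8 + X2 ^ 8 = 0 \<and> X0 * X1 * X2 = sqrt2 * X3 ^ 3"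
      and 1: "\<not> (case X of (X0, X1, X2, X3) \<Rightarrow> X3 = 0)"
      and 2: "supersingular_j (case X of (X0, X1, X2, X3) \<Rightarrow> j_of_weber (X0 / X3))"
    have X3: "X3 \<noteq> 0" using 1 X by simp
    have "supersingular_weber (X0 / X3) (X1 / X3) (X2 / X3)"
    proof (rule supersingular_weberI)
      have "(X0 / X3) ^ 8 + (X1 / X3) ^ 8 + (X2 / X3) ^ 8 = (X0 ^ 8 + X1 ^ 8 + X2 ^ 8) / X3 ^ 8"
        by (simp add: power_divide add_divide_distrib)
      then show "(X0 / X3) ^ 8 + (X1 / X3) ^ 8 + (X2 / X3) ^ 8 = 0" using 0 X by simp
      have "X0 / X3 * (X1 / X3) * (X2 / X3) = X0 * X1 * X2 / X3 ^ 3"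
        by (simp add: power3_eq_cube)
      then show "X0 / X3 * (X1 / X3) * (X2 / X3) = sqrt2" 
        unfolding 0[unfolded X prod.case, THEN conjunct2] using X3 by simp
      show "supersingular_j (j_of_weber (X0 / X3))" using 2 X by simp
    qed
    note in_K = supersingular_weber_in_K[OF this]
    show "case X of (X0, X1, X2, X3) \<Rightarrow>
        \<exists>c. c \<noteq> 0 \<and> c * X0 \<in> K \<and> c * X1 \<in> K \<and> c * X2 \<in> K \<and> c * X3 \<in> K"
      unfolding X prod.case using X3 in_K by (intro exI[of _ "1 / X3"]) simp
  qed
  then show ?thesis by (auto simp: supersingular_weber_invariants_def W24_def)
qed

end
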